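(* Let $n\geq 2$ and let $k_1,\dots,k_n\geq 3$ be integers, not all even, indexed so that for some $t\geq 1$ the integers $k_1,\dots,k_t$ are odd, $k_{t+1},\dots,k_n$ are even, and $k_1\leq k_2\leq\cdots\leq k_t$. Then $fmp(T_{k_1,\ldots ,k_n})=2n$, and $fsmp(T_{k_1,\ldots,k_n})=3$ if $(n,k_2)=(2,4)$, while $fsmp(T_{k_1,\ldots,k_n})=2n$ otherwise.
   Context: The $n$-dimensional torus $T_{k_1,\ldots,k_n}$ (with $k_i\geq 3$) has vertex set $\{(x_1,\dots,x_n):0\leq x_i\leq k_i-1\}$, two vertices being adjacent iff they differ in exactly one coordinate $i$ and there the difference is $\pm1\pmod{k_i}$. A fractional perfect matching of $G$ is $g:E(G)\to[0,1]$ with $\sum_{e\ni v}g(e)=1$ for all $v$. $fmp(G)$ (resp. $fsmp(G)$) is the minimum size of a set $F\subseteq E(G)$ (resp. $F\subseteq V(G)\cup E(G)$) whose deletion (vertices with incident edges, and edges) leaves a graph with no fractional perfect matching. *)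

theory Defs
  imports "HOL-Library.FuncSet" "HOL-Number_Theory.Cong" Complex_Main
begin

record 'a ugraph =
  uverts :: "'a set"
  uedges :: "'a set set"

definition fractional_perfect_matching :: "'a ugraph \<Rightarrow> ('a set \<Rightarrow> real) \<Rightarrow> bool" where
  "fractional_perfect_matching G g \<longleftrightarrow>
     (\<forall>e\<in>uedges G. 0 \<le> g e \<and> g e \<le> 1) \<and>
     (\<forall>v\<in>uverts G. (\<Sum>e\<in>{e \<in> uedges G. v \<in> e}. g e) = 1)"

definition has_fpm :: "'a ugraph \<Rightarrow> bool" where
  "has_fpm G \<longleftrightarrow> (\<exists>g. fractional_perfect_matching G g)"

definition delete :: "'a ugraph \<Rightarrow> 'a set \<Rightarrow> 'a set set \<Rightarrow> 'a ugraph" where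
  "delete G A B =
     \<lparr>uverts = uverts G - A, uedges = {e \<in> uedges G. e \<notin> B \<and> e \<inter> A = {}}\<rparr>"

text \<open>
  For a finite graph with at least one vertex both minima below are attained, since deleting
  all edges leaves no fractional perfect matching; otherwise \<open>LEAST\<close> may be unspecified.
\<close>

definition fmp :: "'a ugraph \<Rightarrow> nat" where
  "fmp G = (LEAST m. \<exists>F. F \<subseteq> uedges G \<and> finite F \<and> card F = m \<and> \<not> has_fpm (delete G {} F))"

text \<open>
  A set of vertices and edges is a subset of the tagged union \<open>uverts G <+> uedges G\<close>.
\<close>

definition fsmp :: "'a ugraph \<Rightarrow> nat" where
  "fsmp G = (LEAST m. \<exists>F. F \<subseteq> uverts G <+> uedges G \<and> finite F \<and> card F = m \<and>
     \<not> has_fpm (delete G (Inl -` F) (Inr -` F)))"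

text \<open>
  Coordinates are indexed by \<open>{1..n}\<close>; vertices are extensional functions, so that each
  tuple \<open>(x\<^sub>1, \<dots>, x\<^sub>n)\<close> is represented exactly once.
\<close>

definition torus_verts :: "nat \<Rightarrow> (nat \<Rightarrow> nat) \<Rightarrow> (nat \<Rightarrow> nat) set" where
  "torus_verts n k = (\<Pi>\<^sub>E i\<in>{1..n}. {x. x < k i})"

definition torus_adj :: "nat \<Rightarrow> (nat \<Rightarrow> nat) \<Rightarrow> (nat \<Rightarrow> nat) \<Rightarrow> (nat \<Rightarrow> nat) \<Rightarrow> bool" where
  "torus_adj n k x y \<longleftrightarrow>
     (\<exists>i\<in>{1..n}. x i \<noteq> y i \<and> (\<forall>j\<in>{1..n}. j \<noteq> i \<longrightarrow> x j = y j) \<and>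
        ([int (x i) - int (y i) = 1] (mod int (k i)) \<or>
         [int (x i) - int (y i) = - 1] (mod int (k i))))"

definition torus :: "nat \<Rightarrow> (nat \<Rightarrow> nat) \<Rightarrow> (nat \<Rightarrow> nat) ugraph" where
  "torus n k =
     \<lparr>uverts = torus_verts n k,
      uedges = {{x, y} | x y. x \<in> torus_verts n k \<and> y \<in> torus_verts n k \<and> torus_adj n k x y}\<rparr>"

end

theory Submission
  imports Defs
begin

text \<open>
  By Hall's theorem in the bipartite double cover, a graph without fractional perfect matching has an
  independent set \<open>I\<close> with fewer than \<open>|I|\<close> neighbours. Let \<open>Q\<close> consist of these neighbours and the
  deleted vertices, and let \<open>X\<close> be the number of torus edges meeting \<open>I\<close> and avoiding \<open>Q\<close>. All these
  edges were deleted, so it suffices to show \<open>|Q| - |I| + X \<ge> 2n - 1\<close> for disjoint \<open>I \<noteq> {}\<close> and \<open>Q\<close>.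

  Cut the torus into the cycles in direction 1, of odd length \<open>k\<^sub>1\<close>. Each of them contributes a
  nonnegative integer, which by parity vanishes only if the cycle misses \<open>I \<union> Q\<close>, or is contained in
  \<open>I \<union> Q\<close> with a majority in \<open>I\<close>. A majority cycle \<open>v\<close> has an edge counted by \<open>X\<close> to every adjacent
  cycle of contribution 0, so \<open>v\<close> and its \<open>2(n - 1)\<close> neighbours in the quotient torus account for
  \<open>2(n - 1)\<close>. If nothing more is gained, every vertex at distance 2 from \<open>v\<close> in the quotient has the
  same neighbours as \<open>v\<close>, which forces the quotient to be a 4-cycle; then \<open>|Q| \<ge> |I|\<close>, so this exception
  does not arise when only edges are deleted. Without majority cycles, a cycle meeting \<open>I\<close> and its
  \<open>2(n - 1)\<close> neighbours account for at least \<open>1\<close> each.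
\<close>

section \<open>Hall's condition and fractional perfect matchings\<close>

text \<open>Induction on the size of \<open>I\<close>. If some proper nonempty \<open>J\<close> is
  tight, match \<open>J\<close> first and the rest outside its neighbourhood; otherwise every such
  subset has a spare neighbour, so one index can be matched arbitrarily.\<close>

lemma hall_marriage:
  assumes "finite I" and "\<And>i. i \<in> I \<Longrightarrow> finite (A i)"
    and "\<And>J. J \<subseteq> I \<Longrightarrow> card J \<le> card (\<Union> (A ` J))"
  shows "\<exists>f. inj_on f I \<and> (\<forall>i\<in>I. f i \<in> A i)"
  using assms
proof (induction "card I" arbitrary: I A rule: less_induct)
  case less
  note fin = less.prems(1) and finA = less.prems(2) and hall = less.prems(3)
  have finU: "finite (\<Union> (A ` J))" if "J \<subseteq> I" for J
    using that fin finA by (meson finite_UN_I finite_subset subsetD)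
  show ?case
  proof (cases "I = {}")
    case True
    then show ?thesis by auto
  next
    case False
    show ?thesis
    proof (cases "\<exists>J. J \<subseteq> I \<and> J \<noteq> {} \<and> J \<noteq> I \<and> card (\<Union> (A ` J)) \<le> card J")
      case True
      then obtain J where J: "J \<subseteq> I" "J \<noteq> {}" "J \<noteq> I" and tight: "card (\<Union> (A ` J)) \<le> card J"
        by blast
      let ?U = "\<Union> (A ` J)"
      have finJ: "finite J" using J fin finite_subset by blast
      have "card J < card I" using J fin by (simp add: psubset_card_mono psubsetI)
      then obtain f where f: "inj_on f J" "\<forall>i\<in>J. f i \<in> A i"
        using less.hyps[of J A] finJ J finA hall by (metis order_trans subsetD)
      have "card (I - J) < card I"
        using J fin by (intro psubset_card_mono) auto
      \<comment> \<open>Hall's condition survives the removal of \<open>?U\<close>: apply it to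
        \<open>K \<union> J\<close> and subtract the tight \<open>J\<close>.\<close>
      moreover have "card K \<le> card (\<Union> ((\<lambda>j. A j - ?U) ` K))" if K: "K \<subseteq> I - J" for K
      proof -
        have finK: "finite K" using K fin by (meson finite_Diff finite_subset)
        have "card K + card J = card (K \<union> J)"
          using K finK finJ by (subst card_Un_disjoint) auto
        also have "\<dots> \<le> card (\<Union> (A ` (K \<union> J)))" using K J by (intro hall) auto
        also have "\<Union> (A ` (K \<union> J)) = \<Union> ((\<lambda>j. A j - ?U) ` K) \<union> ?U" by auto
        also have "card \<dots> \<le> card (\<Union> ((\<lambda>j. A j - ?U) ` K)) + card ?U" by (rule card_Un_le)
        finally show ?thesis using tight by linarith
      qed
      ultimately obtain g where g: "inj_on g (I - J)" "\<forall>i\<in>I - J. g i \<in> A i - ?U"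
        using less.hyps[of "I - J" "\<lambda>j. A j - ?U"] fin finA by auto
      let ?h = "\<lambda>i. if i \<in> J then f i else g i"
      have "inj_on ?h I"
      proof (rule inj_onI)
        fix x y assume xy: "x \<in> I" "y \<in> I" "?h x = ?h y"
        show "x = y"
          using xy f g by (cases "x \<in> J"; cases "y \<in> J") (auto dest: inj_onD, (metis DiffI UN_I)+)
      qed
      moreover have "\<forall>i\<in>I. ?h i \<in> A i" using f g by auto
      ultimately show ?thesis by blast
    next
      case noJ: False
      obtain i where i: "i \<in> I" using False by auto
      have "card {i} \<le> card (A i)" using hall[of "{i}"] i by simp
      then obtain x where x: "x \<in> A i" by fastforce
      have "card K \<le> card (\<Union> ((\<lambda>j. A j - {x}) ` K))" if K: "K \<subseteq> I - {i}" for K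
      proof (cases "K = {}")
        case nonempty: False
        have "card K < card (\<Union> (A ` K))" 
        proof -
          have "K \<subseteq> I" "K \<noteq> I" using K i by auto
          then show ?thesis using noJ nonempty not_le by blast
        qed
        moreover have "\<Union> ((\<lambda>j. A j - {x}) ` K) = \<Union> (A ` K) - {x}" by auto
        moreover have "card (\<Union> (A ` K)) \<le> Suc (card (\<Union> (A ` K) - {x}))"
          by (auto simp: card_Diff_singleton_if)
        ultimately show ?thesis by simp
      qed simp
      moreover have "card (I - {i}) < card I" using i fin by (rule card_Diff1_less[rotated])
      ultimately obtain g where g: "inj_on g (I - {i})" "\<forall>j\<in>I - {i}. g j \<in> A j - {x}"
        using less.hyps[of "I - {i}" "\<lambda>j. A j - {x}"] fin finA by auto
      have "inj_on (g(i := x)) I"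
      proof (rule inj_onI)
        fix a b assume ab: "a \<in> I" "b \<in> I" "(g(i := x)) a = (g(i := x)) b"
        show "a = b"
          using ab g by (cases "a = i"; cases "b = i") (auto dest: inj_onD)
      qed
      moreover have "\<forall>j\<in>I. (g(i := x)) j \<in> A j" using g x by auto
      ultimately show ?thesis by blast
    qed
  qed
qed

section \<open>Finite simple graphs and half-integral matchings\<close>

definition simple_graph :: "'a ugraph \<Rightarrow> bool" where
  "simple_graph G \<longleftrightarrow> finite (uverts G) \<and>
     (\<forall>e\<in>uedges G. \<exists>x\<in>uverts G. \<exists>y\<in>uverts G. x \<noteq> y \<and> e = {x, y})"

definition nbrs :: "'a ugraph \<Rightarrow> 'a set \<Rightarrow> 'a set" where
  "nbrs G A = {y. \<exists>x\<in>A. {x, y} \<in> uedges G}"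

lemma simple_graph_edgeD:
  assumes "simple_graph G" "{x, y} \<in> uedges G"
  shows "x \<in> uverts G" "y \<in> uverts G" "x \<noteq> y"
  using assms unfolding simple_graph_def by (auto simp: doubleton_eq_iff dest!: bspec)

lemma nbrs_subset: "simple_graph G \<Longrightarrow> nbrs G A \<subseteq> uverts G"
  unfolding nbrs_def using simple_graph_edgeD by fast

lemma finite_uedges: "simple_graph G \<Longrightarrow> finite (uedges G)"
  unfolding simple_graph_def
  by (rule finite_subset[of _ "Pow (uverts G)"]) auto

lemma simple_graph_delete:
  assumes "simple_graph G"
  shows "simple_graph (delete G A B)"
  using assms unfolding simple_graph_def delete_def by fastforce

text \<open>The matching is half-integral: the edges \<open>{v, \<sigma> v}\<close> of a permutation \<open>\<sigma>\<close> along edges,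
  that is, of a perfect matching of the bipartite double cover, each get weight \<open>1/2\<close>.\<close>

lemma has_fpm_of_expansion:
  assumes G: "simple_graph G"
    and exp: "\<And>A. A \<subseteq> uverts G \<Longrightarrow> card A \<le> card (nbrs G A)"
  shows "has_fpm G"
proof -
  let ?V = "uverts G"
  have finV: "finite ?V" using G by (simp add: simple_graph_def)
  have fin: "finite (nbrs G A)" for A
    using nbrs_subset[OF G] finV finite_subset by blast
  have "\<Union> ((\<lambda>v. nbrs G {v}) ` J) = nbrs G J" for J
    by (auto simp: nbrs_def)
  then obtain \<sigma> where inj: "inj_on \<sigma> ?V" and "\<forall>v\<in>?V. \<sigma> v \<in> nbrs G {v}"
    using hall_marriage[of ?V "\<lambda>v. nbrs G {v}"] finV fin exp by auto
  then have \<sigma>: "{v, \<sigma> v} \<in> uedges G" if "v \<in> ?V" for v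
    using that by (auto simp: nbrs_def)
  have \<sigma>V: "\<sigma> v \<in> ?V" "v \<noteq> \<sigma> v" if "v \<in> ?V" for v
    using simple_graph_edgeD[OF G \<sigma>[OF that]] by auto
  have surj: "\<sigma> ` ?V = ?V"
    using \<sigma>V inj finV by (simp add: card_image card_subset_eq image_subset_iff)
  \<comment> \<open>An edge whose ends are exchanged by \<open>\<sigma>\<close> is counted from both
    ends and gets weight 1.\<close>
  define g where "g e = real (card {v \<in> ?V. {v, \<sigma> v} = e}) / 2" for e
  have sum1: "(\<Sum>e\<in>{e \<in> uedges G. v \<in> e}. g e) = 1" if v: "v \<in> ?V" for v
  proof -
    obtain u where u: "u \<in> ?V" "\<sigma> u = v" using surj v by (metis imageE)
    \<comment> \<open>The edges \<open>{w, \<sigma> w}\<close> through \<open>v\<close> come from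
      exactly two \<open>w\<close>: \<open>v\<close> itself and its preimage \<open>u\<close>,
      distinct because there are no loops.\<close>
    have "(\<Sum>e\<in>{e \<in> uedges G. v \<in> e}. card {w \<in> ?V. {w, \<sigma> w} = e})
        = card (\<Union>e\<in>{e \<in> uedges G. v \<in> e}. {w \<in> ?V. {w, \<sigma> w} = e})"
      using finV finite_uedges[OF G] by (subst card_UN_disjoint) auto
    also have "(\<Union>e\<in>{e \<in> uedges G. v \<in> e}. {w \<in> ?V. {w, \<sigma> w} = e}) = {w \<in> ?V. v \<in> {w, \<sigma> w}}"
      using \<sigma> by auto
    also have "\<dots> = {v, u}" using u v inj by (auto dest: inj_onD)
    also have "card \<dots> = 2" using u \<sigma>V by (metis card_2_iff)
    finally show ?thesis unfolding g_def
      by (simp flip: sum_divide_distrib of_nat_sum)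
  qed
  have ge0: "0 \<le> g e" for e by (simp add: g_def)
  have "g e \<le> 1" if e: "e \<in> uedges G" for e
  proof -
    obtain v where v: "v \<in> ?V" "v \<in> e" using G e unfolding simple_graph_def by blast
    have "g e \<le> (\<Sum>e\<in>{e \<in> uedges G. v \<in> e}. g e)"
      using e v finite_uedges[OF G] ge0 by (intro member_le_sum) auto
    then show ?thesis using sum1 v by simp
  qed
  then show ?thesis
    unfolding has_fpm_def fractional_perfect_matching_def using sum1 ge0 by blast
qed

text \<open>A violator \<open>A\<close> of Hall's condition in the double cover yields the independent violator
  \<open>A - N(A)\<close> in the graph itself.\<close>

lemma independent_set_if_not_has_fpm:
  assumes G: "simple_graph G" and "\<not> has_fpm G"
  shows "\<exists>I\<subseteq>uverts G. nbrs G I \<inter> I = {} \<and> card (nbrs G I) < card I"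
proof -
  obtain A where A: "A \<subseteq> uverts G" "card (nbrs G A) < card A"
    using has_fpm_of_expansion[OF G] assms(2) by (meson not_le)
  have finV: "finite (uverts G)" using G by (simp add: simple_graph_def)
  have fin: "finite A" "finite (nbrs G A)"
    using A(1) finV nbrs_subset[OF G] by (auto intro: finite_subset)
  let ?I = "A - nbrs G A"
  \<comment> \<open>If a neighbour of \<open>x \<in> ?I\<close> lay in \<open>A\<close>, then
    \<open>x\<close> would lie in \<open>nbrs G A\<close>.\<close>
  have sub: "nbrs G ?I \<subseteq> nbrs G A - A"
    unfolding nbrs_def by (auto, metis insert_commute)
  have "card (nbrs G ?I) \<le> card (nbrs G A - A)" using sub fin by (intro card_mono) auto
  also have "\<dots> = card (nbrs G A) - card (nbrs G A \<inter> A)" using fin by (simp add: card_Diff_subset_Int)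
  also have "\<dots> < card A - card (nbrs G A \<inter> A)"
    using A(2) fin card_mono[of "nbrs G A" "nbrs G A \<inter> A"] by (simp add: diff_less_mono)
  also have "\<dots> = card ?I" using fin by (simp add: card_Diff_subset_Int Int_commute)
  finally show ?thesis using sub A(1) by (intro exI[of _ ?I]) auto
qed

text \<open>Weighted double counting: the weights at the vertices of \<open>I\<close> add up to
  \<open>card I\<close>, and each edge contributes at most as much there as at \<open>Q\<close>, so
  a matching would give \<open>card I \<le> card Q\<close>.\<close>

lemma not_has_fpm_of_small_nbrs:
  assumes G: "simple_graph G" and "I \<subseteq> uverts G" "Q \<subseteq> uverts G" "card Q < card I"
    and cover: "\<And>e. e \<in> uedges G \<Longrightarrow> e \<inter> I \<noteq> {} \<Longrightarrow> e \<inter> Q \<noteq> {} \<and> card (e \<inter> I) = 1"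
  shows "\<not> has_fpm G"
proof
  assume "has_fpm G"
  then obtain g where g: "fractional_perfect_matching G g" by (auto simp: has_fpm_def)
  let ?E = "uedges G"
  have finE: "finite ?E" using finite_uedges[OF G] .
  have finV: "finite I" "finite Q"
    using assms G by (auto simp: simple_graph_def intro: finite_subset)
  have double: "(\<Sum>v\<in>S. \<Sum>e\<in>{e \<in> ?E. v \<in> e}. g e) = (\<Sum>e\<in>?E. of_nat (card (e \<inter> S)) * g e)"
    if "finite S" for S
  proof -
    have "(\<Sum>v\<in>S. \<Sum>e\<in>{e \<in> ?E. v \<in> e}. g e) = (\<Sum>e\<in>?E. \<Sum>v\<in>{v \<in> S. v \<in> e}. g e)"
      using that finE by (rule sum.swap_restrict)
    also have "\<dots> = (\<Sum>e\<in>?E. of_nat (card (e \<inter> S)) * g e)"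
      by (intro sum.cong) (auto simp: Int_def conj_commute)
    finally show ?thesis .
  qed
  have total: "(\<Sum>v\<in>S. \<Sum>e\<in>{e \<in> ?E. v \<in> e}. g e) = real (card S)" if "S \<subseteq> uverts G" for S
    using g that unfolding fractional_perfect_matching_def by (simp add: subset_iff)
  have "real (card I) = (\<Sum>e\<in>?E. of_nat (card (e \<inter> I)) * g e)"
    using double[OF finV(1)] total[OF assms(2)] by simp
  also have "\<dots> \<le> (\<Sum>e\<in>?E. of_nat (card (e \<inter> Q)) * g e)"
  proof (rule sum_mono)
    fix e assume e: "e \<in> ?E"
    have "card (e \<inter> I) \<le> card (e \<inter> Q)"
    proof (cases "e \<inter> I = {}")
      case False
      then have "card (e \<inter> I) = 1" "e \<inter> Q \<noteq> {}" using cover e by auto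
      then show ?thesis using finV by (simp add: Suc_le_eq card_gt_0_iff)
    qed simp
    moreover have "0 \<le> g e" using g e by (auto simp: fractional_perfect_matching_def)
    ultimately show "real (card (e \<inter> I)) * g e \<le> real (card (e \<inter> Q)) * g e"
      by (simp add: mult_right_mono)
  qed
  also have "\<dots> = real (card Q)" using double[OF finV(2)] total[OF assms(3)] by simp
  finally show False using assms(4) by simp
qed

section \<open>Signed odd cycles\<close>

text \<open>The values \<open>-1\<close>, \<open>1\<close>, \<open>0\<close> mark membership in \<open>I\<close>, in \<open>Q\<close>, and in neither; an edge is bad if it
  meets \<open>I\<close> and avoids \<open>Q\<close>.\<close>

definition bad :: "int \<Rightarrow> int \<Rightarrow> bool" where
  "bad a b \<longleftrightarrow> (a = -1 \<or> b = -1) \<and> a \<noteq> 1 \<and> b \<noteq> 1"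

text \<open>The share of one cycle in direction 1, with its own edges, in |Q| - |I| + X.\<close>

definition line_excess :: "nat \<Rightarrow> (nat \<Rightarrow> int) \<Rightarrow> int" where
  "line_excess m s = (\<Sum>p<m. s p) + int (card {p. p < m \<and> bad (s p) (s (Suc p mod m))})"

definition cross :: "nat \<Rightarrow> (nat \<Rightarrow> int) \<Rightarrow> (nat \<Rightarrow> int) \<Rightarrow> int" where
  "cross m s s' = int (card {p. p < m \<and> bad (s p) (s' p)})"

definition sign_seq :: "(nat \<Rightarrow> int) \<Rightarrow> bool" where
  "sign_seq s \<longleftrightarrow> (\<forall>p. s p \<in> {-1, 0, 1})"

abbreviation minus_card :: "nat \<Rightarrow> (nat \<Rightarrow> int) \<Rightarrow> int" where
  "minus_card m s \<equiv> int (card {p. p < m \<and> s p = -1})"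

abbreviation plus_card :: "nat \<Rightarrow> (nat \<Rightarrow> int) \<Rightarrow> int" where
  "plus_card m s \<equiv> int (card {p. p < m \<and> s p = 1})"

text \<open>A majority cycle; neighbouring signs may agree.\<close>

definition alternating :: "nat \<Rightarrow> (nat \<Rightarrow> int) \<Rightarrow> bool" where
  "alternating m s \<longleftrightarrow> (\<forall>p<m. s p = 1 \<or> s p = -1) \<and> plus_card m s < minus_card m s"

lemma sign_seqD: "sign_seq s \<Longrightarrow> s p = -1 \<or> s p = 0 \<or> s p = 1"
  by (auto simp: sign_seq_def)

lemma cross_commute: "cross m s s' = cross m s' s"
  unfolding cross_def bad_def by (rule arg_cong[where f = "\<lambda>A. int (card A)"]) auto

lemma cross_nonneg: "0 \<le> cross m s s'"
  by (simp add: cross_def)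

lemma card_as_sum:
  fixes m :: nat
  shows "int (card {p. p < m \<and> P p}) = (\<Sum>p<m. of_bool (P p))"
proof (induction m)
  case (Suc m)
  have "{p. p < Suc m \<and> P p} = {p. p < m \<and> P p} \<union> (if P m then {m} else {})"
    by (auto simp: less_Suc_eq)
  then show ?case using Suc by simp
qed simp

lemma sum_sign_seq:
  assumes "sign_seq s"
  shows "(\<Sum>p<m. s p) = plus_card m s - minus_card m s"
  unfolding card_as_sum sum_subtractf[symmetric]
  using sign_seqD[OF assms] by (intro sum.cong) (fastforce simp: of_bool_def)+

lemma sum_shift_mod:
  fixes s :: "nat \<Rightarrow> int"
  assumes "0 < m"
  shows "(\<Sum>p<m. s (Suc p mod m)) = (\<Sum>p<m. s p)"
proof -
  obtain l where m: "m = Suc l" using assms gr0_implies_Suc by blast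
  have "(\<Sum>p<m. s (Suc p mod m)) = (\<Sum>p<l. s (Suc p mod m)) + s 0" by (simp add: m)
  also have "(\<Sum>p<l. s (Suc p mod m)) = (\<Sum>p<l. s (Suc p))" by (intro sum.cong) (auto simp: m)
  also have "\<dots> + s 0 = (\<Sum>p<m. s p)" unfolding m sum.lessThan_Suc_shift by simp
  finally show ?thesis .
qed

text \<open>The summand is \<open>0\<close> for adjacent values \<open>{-1, 1}\<close>, \<open>{-1, -1}\<close> and \<open>{0, 0}\<close>, and positive
  otherwise.\<close>

lemma double_line_excess:
  assumes "0 < m"
  shows "2 * line_excess m s =
    (\<Sum>p<m. s p + s (Suc p mod m) + 2 * of_bool (bad (s p) (s (Suc p mod m))))"
  unfolding line_excess_def card_as_sum
  by (simp add: sum.distrib sum_shift_mod[OF assms] sum_distrib_left)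

lemma edge_excess_nonneg:
  assumes "sign_seq s"
  shows "0 \<le> s p + s q + 2 * of_bool (bad (s p) (s q))"
  using sign_seqD[OF assms, of p] sign_seqD[OF assms, of q] by (auto simp: bad_def)

lemma line_excess_nonneg:
  assumes "0 < m" "sign_seq s"
  shows "0 \<le> line_excess m s"
proof -
  have "0 \<le> 2 * line_excess m s"
    unfolding double_line_excess[OF assms(1)] by (intro sum_nonneg edge_excess_nonneg assms(2))
  then show ?thesis by simp
qed

lemma line_excess_ge_edge:
  assumes "0 < m" "sign_seq s" "p < m"
  shows "s p + s (Suc p mod m) + 2 * of_bool (bad (s p) (s (Suc p mod m))) \<le> 2 * line_excess m s"
  unfolding double_line_excess[OF assms(1)]
  using assms edge_excess_nonneg[OF assms(2)]
  by (intro member_le_sum[of p "{..<m}"]) auto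

lemma line_excess_ge: "(\<Sum>p<m. s p) \<le> line_excess m s"
  by (simp add: line_excess_def)

text \<open>The edge summands are nonnegative and add up to 0, so each vanishes, and zeros propagate
  around the whole cycle. On a cycle without zeros the excess bounds the sign sum from above, so the
  plus signs do not prevail, and a tie would make \<open>m\<close> even.\<close>

lemma line_excess_zero_cases:
  assumes m: "odd m" and s: "sign_seq s" and "line_excess m s = 0"
  shows "(\<forall>p<m. s p = 0) \<or> alternating m s"
proof -
  have m0: "0 < m" using m by (rule odd_pos)
  have step: "s p = 0 \<longleftrightarrow> s (Suc p mod m) = 0" if "p < m" for p
  proof -
    have "s p + s (Suc p mod m) + 2 * of_bool (bad (s p) (s (Suc p mod m))) \<le> 0"
      using line_excess_ge_edge[OF m0 s that] assms(3) by simp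
    then show ?thesis
      using sign_seqD[OF s, of p] sign_seqD[OF s, of "Suc p mod m"]
      by (elim disjE) (simp_all add: bad_def)
  qed
  have all: "s p = 0 \<longleftrightarrow> s 0 = 0" if "p < m" for p
    using that
  proof (induction p)
    case (Suc p)
    then have "p < m" "Suc p mod m = Suc p" by simp_all
    then show ?case using step[of p] Suc.IH by metis
  qed simp
  show ?thesis
  proof (cases "s 0 = 0")
    case True
    then show ?thesis using all by blast
  next
    case False
    then have pm: "s p = 1 \<or> s p = -1" if "p < m" for p
      using all[OF that] False sign_seqD[OF s, of p] by metis
    have "plus_card m s + minus_card m s = (\<Sum>p<m. 1)"
      unfolding card_as_sum sum.distrib[symmetric]
      using pm by (intro sum.cong) (auto simp: of_bool_def)
    then have tot: "plus_card m s + minus_card m s = int m" by simp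
    have "plus_card m s \<le> minus_card m s"
      using line_excess_ge[of s m] assms(3) sum_sign_seq[OF s, of m] by simp
    moreover have "plus_card m s \<noteq> minus_card m s"
    proof
      assume "plus_card m s = minus_card m s"
      then have "int m = 2 * plus_card m s" using tot by simp
      then show False using m by presburger
    qed
    ultimately show ?thesis using pm by (auto simp: alternating_def)
  qed
qed

lemma alternating_total:
  assumes "alternating m s"
  shows "plus_card m s + minus_card m s = int m"
proof -
  have "plus_card m s + minus_card m s = (\<Sum>p<m. 1)"
    unfolding card_as_sum sum.distrib[symmetric]
    using assms by (intro sum.cong) (auto simp: of_bool_def alternating_def)
  then show ?thesis by simp
qed

lemma alternating_minus_card:
  assumes "alternating m s" "3 \<le> m"
  shows "2 \<le> minus_card m s"
  using alternating_total[OF assms(1)] assms by (auto simp: alternating_def)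

section \<open>Bad edges between parallel cycles\<close>

lemma cross_zero_iff:
  "cross m s s' = 0 \<longleftrightarrow> (\<forall>p<m. \<not> bad (s p) (s' p))"
  by (auto simp: cross_def)

lemma minus_card_le_plus_card:
  assumes "cross m s s' = 0" "sign_seq s" "sign_seq s'"
  shows "minus_card m s \<le> plus_card m s'"
proof -
  have "{p. p < m \<and> s p = -1} \<subseteq> {p. p < m \<and> s' p = 1}"
    using assms by (auto simp: cross_zero_iff bad_def)
  then show ?thesis by (simp add: card_mono)
qed

lemma cross_alternating_zero:
  assumes "alternating m s" "\<And>p. p < m \<Longrightarrow> s' p = 0"
  shows "minus_card m s \<le> cross m s s'"
  unfolding cross_def of_nat_le_iff
  using assms by (intro card_mono) (auto simp: bad_def)

text \<open>Otherwise the minus signs of either cycle would face plus signs of the other, so each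
  majority would fit into the other cycle's minority.\<close>

lemma cross_alternating_alternating:
  assumes "alternating m s" "alternating m s'"
  shows "1 \<le> cross m s s'"
proof (rule ccontr)
  assume "\<not> 1 \<le> cross m s s'"
  then have "cross m s s' = 0" using cross_nonneg[of m s s'] by linarith
  then have "{p. p < m \<and> s p = -1} \<subseteq> {p. p < m \<and> s' p = 1}"
    using assms by (auto simp: cross_zero_iff bad_def alternating_def)
  then have "minus_card m s \<le> plus_card m s'" by (simp add: card_mono)
  moreover have "{p. p < m \<and> s' p = -1} \<subseteq> {p. p < m \<and> s p = 1}"
    using \<open>cross m s s' = 0\<close> assms by (auto simp: cross_zero_iff bad_def alternating_def)
  then have "minus_card m s' \<le> plus_card m s" by (simp add: card_mono)
  ultimately show False using assms by (auto simp: alternating_def)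
qed

text \<open>Every \<open>-1\<close> of \<open>s\<close> faces a \<open>1\<close> in both
  \<open>a\<close> and \<open>b\<close>, while the minus signs of \<open>a\<close> and
  \<open>b\<close> occupy disjoint positions among the plus signs of \<open>s\<close>. Hence the two
  excesses add up to more than \<open>minus_card m s\<close>, which is at least 2.\<close>

lemma triangle_one_alternating:
  assumes alt: "alternating m s" and m: "3 \<le> m" and sgn: "sign_seq s" "sign_seq a" "sign_seq b"
    and zero: "cross m s a = 0" "cross m s b = 0" "cross m a b = 0"
  shows "3 \<le> line_excess m a + line_excess m b"
proof -
  have disj: "{p. p < m \<and> a p = -1} \<inter> {p. p < m \<and> b p = -1} = {}"
    using zero(3) by (auto simp: cross_zero_iff bad_def)
  have "{p. p < m \<and> a p = -1} \<union> {p. p < m \<and> b p = -1} \<subseteq> {p. p < m \<and> s p = 1}"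
    using zero(1,2) alt by (auto simp: cross_zero_iff bad_def alternating_def)
  then have "card ({p. p < m \<and> a p = -1} \<union> {p. p < m \<and> b p = -1}) \<le> card {p. p < m \<and> s p = 1}"
    by (intro card_mono) auto
  then have "minus_card m a + minus_card m b \<le> plus_card m s"
    by (simp add: card_Un_disjoint[OF _ _ disj])
  moreover have "minus_card m s \<le> plus_card m a" "minus_card m s \<le> plus_card m b"
    using minus_card_le_plus_card zero sgn by blast+
  moreover have "plus_card m a - minus_card m a \<le> line_excess m a"
    "plus_card m b - minus_card m b \<le> line_excess m b"
    using line_excess_ge sum_sign_seq sgn by metis+
  moreover have "plus_card m s < minus_card m s" using alt by (simp add: alternating_def)
  ultimately show ?thesis using alternating_minus_card[OF alt m] by linarith
qed

text \<open>Positions where \<open>s\<close> and \<open>s'\<close> are both \<open>-1\<close> are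
  bad, so there is at most one; the two majorities therefore cover all \<open>m\<close> positions,
  and \<open>a\<close> must be \<open>1\<close> everywhere.\<close>

lemma triangle_two_alternating:
  assumes alt: "alternating m s" "alternating m s'" and m: "3 \<le> m"
    and sgn: "sign_seq a"
    and one: "cross m s s' \<le> 1" and zero: "cross m s a = 0" "cross m s' a = 0"
  shows "3 \<le> line_excess m a"
proof -
  let ?M = "\<lambda>s. {p. p < m \<and> s p = -1}"
  have "?M s \<inter> ?M s' \<subseteq> {p. p < m \<and> bad (s p) (s' p)}" by (auto simp: bad_def)
  then have "card (?M s \<inter> ?M s') \<le> card {p. p < m \<and> bad (s p) (s' p)}"
    by (intro card_mono) auto
  then have i: "int (card (?M s \<inter> ?M s')) \<le> 1" using one by (simp add: cross_def)
  have "?M s \<union> ?M s' \<subseteq> {p. p < m \<and> a p = 1}"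
    using zero sgn by (auto simp: cross_zero_iff bad_def)
  then have "card (?M s \<union> ?M s') \<le> card {p. p < m \<and> a p = 1}" by (intro card_mono) auto
  moreover have "card (?M s) + card (?M s') = card (?M s \<union> ?M s') + card (?M s \<inter> ?M s')"
    by (rule card_Un_Int) auto
  ultimately have "int m \<le> plus_card m a"
    using i alternating_total[OF alt(1)] alternating_total[OF alt(2)] alt
    unfolding alternating_def by linarith
  then have "m \<le> card {p. p < m \<and> a p = 1}" by simp
  then have "{p. p < m \<and> a p = 1} = {..<m}"
    by (intro card_seteq) auto
  then have "\<forall>p<m. a p = 1" by blast
  then have "(\<Sum>p<m. a p) = int m" by simp
  then show ?thesis using line_excess_ge[of a m] m by linarith
qed

section \<open>Cycles over a quotient graph\<close>

text \<open>In the application \<open>U\<close> and \<open>nb\<close> form the quotient torus of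
  dimension \<open>d\<close>, and \<open>\<sigma> u\<close> lists the signs along the cycle over
  \<open>u\<close>.\<close>

locale line_system =
  fixes U :: "'u set" and nb :: "'u \<Rightarrow> 'u set" and m d :: nat and \<sigma> :: "'u \<Rightarrow> nat \<Rightarrow> int"
  assumes finite_U: "finite U"
    and nb_subset: "u \<in> U \<Longrightarrow> nb u \<subseteq> U"
    and nb_irrefl: "u \<notin> nb u"
    and nb_sym: "w \<in> nb u \<Longrightarrow> u \<in> nb w"
    and degree: "u \<in> U \<Longrightarrow> 2 * d \<le> card (nb u)"
    and d_pos: "1 \<le> d"
    and odd_m: "odd m" and m_ge_3: "3 \<le> m"
    and signs: "sign_seq (\<sigma> u)"
begin

definition nb_pairs :: "'u set set" where
  "nb_pairs = {{u, w} | u w. u \<in> U \<and> w \<in> nb u}"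

text \<open>Defined on unordered pairs, so that summing over \<open>nb_pairs\<close> counts every
  bad edge between cycles once.\<close>

definition pair_cross :: "'u set \<Rightarrow> int" where
  "pair_cross e = int (card {p. p < m \<and> -1 \<in> (\<lambda>u. \<sigma> u p) ` e \<and> 1 \<notin> (\<lambda>u. \<sigma> u p) ` e})"

definition total_excess :: int where
  "total_excess = (\<Sum>u\<in>U. line_excess m (\<sigma> u)) + (\<Sum>e\<in>nb_pairs. pair_cross e)"

abbreviation "le u \<equiv> line_excess m (\<sigma> u)"
abbreviation "cr u w \<equiv> cross m (\<sigma> u) (\<sigma> w)"
abbreviation "alt u \<equiv> alternating m (\<sigma> u)"

section \<open>Total excess seen from one cycle\<close>

lemma m_pos: "0 < m" using m_ge_3 by simp

lemma le_nonneg: "0 \<le> le u"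
  by (rule line_excess_nonneg[OF m_pos signs])

lemma pair_cross_nonneg: "0 \<le> pair_cross e"
  by (simp add: pair_cross_def)

lemma pair_cross_pair: "pair_cross {u, w} = cr u w"
  unfolding pair_cross_def cross_def bad_def
  by (rule arg_cong[where f = "\<lambda>A. int (card A)"]) auto

lemma finite_nb: "u \<in> U \<Longrightarrow> finite (nb u)"
  using nb_subset finite_U finite_subset by blast

lemma finite_nb_pairs: "finite nb_pairs"
  by (rule finite_subset[of _ "Pow U"]) (use finite_U nb_subset in \<open>auto simp: nb_pairs_def\<close>)

lemma total_excess_split:
  assumes v: "v \<in> U"
  shows "total_excess = le v + (\<Sum>u\<in>nb v. le u + cr v u)
    + (\<Sum>u\<in>U - insert v (nb v). le u) + (\<Sum>e\<in>{e \<in> nb_pairs. v \<notin> e}. pair_cross e)"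
proof -
  have star: "{e \<in> nb_pairs. v \<in> e} = (\<lambda>u. {v, u}) ` nb v"
    using v nb_sym nb_subset[OF v] by (auto simp: nb_pairs_def insert_commute)
  have inj: "inj_on (\<lambda>u. {v, u}) (nb v)"
    by (auto intro!: inj_onI simp: doubleton_eq_iff)
  have "nb_pairs = {e \<in> nb_pairs. v \<in> e} \<union> {e \<in> nb_pairs. v \<notin> e}" by auto
  then have "(\<Sum>e\<in>nb_pairs. pair_cross e)
      = (\<Sum>e\<in>{e \<in> nb_pairs. v \<in> e}. pair_cross e) + (\<Sum>e\<in>{e \<in> nb_pairs. v \<notin> e}. pair_cross e)"
    using sum.union_disjoint[of "{e \<in> nb_pairs. v \<in> e}" "{e \<in> nb_pairs. v \<notin> e}" pair_cross]
      finite_nb_pairs by auto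
  moreover have "(\<Sum>e\<in>{e \<in> nb_pairs. v \<in> e}. pair_cross e) = (\<Sum>u\<in>nb v. cr v u)"
    unfolding star by (simp add: sum.reindex[OF inj] pair_cross_pair)
  moreover have "(\<Sum>u\<in>U. le u) = le v + (\<Sum>u\<in>nb v. le u) + (\<Sum>u\<in>U - insert v (nb v). le u)"
  proof -
    have "(\<Sum>u\<in>U. le u) = (\<Sum>u\<in>U - insert v (nb v). le u) + (\<Sum>u\<in>insert v (nb v). le u)"
      using v nb_subset[OF v] finite_U by (intro sum.subset_diff) auto
    then show ?thesis using finite_nb[OF v] nb_irrefl by simp
  qed
  ultimately show ?thesis unfolding total_excess_def by (simp add: sum.distrib)
qed

text \<open>A neighbour of excess 0 is empty or alternating, and both kinds have a bad edge to an
  alternating cycle.\<close>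

lemma nb_contribution_alt:
  assumes "alt v" "u \<in> nb v"
  shows "1 \<le> le u + cr v u"
proof (cases "le u = 0")
  case True
  from line_excess_zero_cases[OF odd_m signs True] show ?thesis
  proof
    assume "\<forall>p<m. \<sigma> u p = 0"
    then have "minus_card m (\<sigma> v) \<le> cr v u"
      using cross_alternating_zero[OF assms(1)] by blast
    then show ?thesis using alternating_minus_card[OF assms(1) m_ge_3] True by linarith
  next
    assume "alt u"
    then show ?thesis using cross_alternating_alternating[OF assms(1)] True by fastforce
  qed
next
  case False
  then show ?thesis using le_nonneg[of u] cross_nonneg[of m "\<sigma> v" "\<sigma> u"] by linarith
qed

lemma total_excess_ge_alt:
  assumes "v \<in> U" "alt v"
  shows "2 * int d \<le> total_excess"
proof -
  have "int (card (nb v)) \<le> (\<Sum>u\<in>nb v. le u + cr v u)"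
    using sum_mono[of "nb v" "\<lambda>_. 1" "\<lambda>u. le u + cr v u"] nb_contribution_alt[OF assms(2)] by simp
  moreover have "0 \<le> (\<Sum>u\<in>U - insert v (nb v). le u)"
    "0 \<le> (\<Sum>e\<in>{e \<in> nb_pairs. v \<notin> e}. pair_cross e)"
    using le_nonneg pair_cross_nonneg by (simp_all add: sum_nonneg)
  ultimately show ?thesis
    using total_excess_split[OF assms(1)] le_nonneg[of v] degree[OF assms(1)] by linarith
qed

text \<open>Now excess 0 means empty. The \<open>-1\<close> of \<open>v\<close> creates a bad edge
  to each empty neighbour, and the positive excess of \<open>v\<close> itself makes the inequality
  strict.\<close>

lemma total_excess_gt_no_alt:
  assumes v: "v \<in> U" and p: "p < m" "\<sigma> v p = -1" and no_alt: "\<And>u. u \<in> U \<Longrightarrow> \<not> alt u"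
  shows "2 * int d < total_excess"
proof -
  have zero: "\<forall>p<m. \<sigma> u p = 0" if "u \<in> U" "le u = 0" for u
    using line_excess_zero_cases[OF odd_m signs that(2)] no_alt[OF that(1)] by blast
  have "le v \<noteq> 0" using zero[OF v] p by auto
  then have "1 \<le> le v" using le_nonneg[of v] by linarith
  moreover have "1 \<le> le u + cr v u" if u: "u \<in> nb v" for u
  proof (cases "le u = 0")
    case True
    then have "\<sigma> u p = 0" using zero nb_subset[OF v] u p by auto
    then have "cr v u \<noteq> 0" using p by (auto simp: cross_zero_iff bad_def)
    then show ?thesis using cross_nonneg[of m "\<sigma> v" "\<sigma> u"] True by linarith
  next
    case False
    then show ?thesis using le_nonneg[of u] cross_nonneg[of m "\<sigma> v" "\<sigma> u"] by linarith
  qed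
  then have "int (card (nb v)) \<le> (\<Sum>u\<in>nb v. le u + cr v u)"
    using sum_mono[of "nb v" "\<lambda>_. 1" "\<lambda>u. le u + cr v u"] by simp
  moreover have "0 \<le> (\<Sum>u\<in>U - insert v (nb v). le u)"
    "0 \<le> (\<Sum>e\<in>{e \<in> nb_pairs. v \<notin> e}. pair_cross e)"
    using le_nonneg pair_cross_nonneg by (simp_all add: sum_nonneg)
  ultimately show ?thesis
    using total_excess_split[OF v] degree[OF v] by linarith
qed

lemma total_excess_ge:
  assumes "v \<in> U" "p < m" "\<sigma> v p = -1"
  shows "2 * int d \<le> total_excess"
  using total_excess_ge_alt total_excess_gt_no_alt[OF assms] by (meson less_imp_le)

section \<open>Equality in the excess bound\<close>

lemma nb_other:
  assumes "u \<in> U"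
  shows "\<exists>w\<in>nb u. w \<noteq> v"
proof (rule ccontr)
  assume "\<not> ?thesis"
  then have "nb u \<subseteq> {v}" by auto
  then have "card (nb u) \<le> 1" using card_mono[of "{v}" "nb u"] by simp
  then show False using degree[OF assms] d_pos by simp
qed

text \<open>With equality, each neighbour of \<open>v\<close> contributes exactly 1, cycles farther
  away have excess 0, and bad edges between distinct cycles occur only at \<open>v\<close>. The
  triangle lemmas then restrict the signs around \<open>v\<close>.\<close>

lemma tight_structure:
  assumes v: "v \<in> U" and altv: "alt v" and tight: "total_excess \<le> 2 * int d"
  shows "(\<forall>u\<in>nb v. cr v u = 0) \<and>
    (\<forall>u\<in>nb v. \<forall>w\<in>nb u. w \<noteq> v \<longrightarrow> w \<notin> nb v \<and> nb w \<subseteq> nb v \<and> alt w \<and> cr w u = 0)"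
proof -
  have contr: "0 \<le> le u + cr v u - 1" if "u \<in> nb v" for u
    using nb_contribution_alt[OF altv that] by simp
  \<comment> \<open>These are the surpluses over the degree bound; they are nonnegative and turn out
    to vanish.\<close>
  let ?S1 = "\<Sum>u\<in>nb v. le u + cr v u - 1"
  let ?S2 = "\<Sum>u\<in>U - insert v (nb v). le u"
  let ?S3 = "\<Sum>e\<in>{e \<in> nb_pairs. v \<notin> e}. pair_cross e"
  have "?S1 = (\<Sum>u\<in>nb v. le u + cr v u) - int (card (nb v))"
    by (simp add: sum_subtractf)
  then have "le v + ?S1 + ?S2 + ?S3 \<le> 0"
    using total_excess_split[OF v] degree[OF v] tight by linarith
  moreover have "0 \<le> ?S1" using contr by (intro sum_nonneg) auto
  moreover have "0 \<le> ?S2" "0 \<le> ?S3"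
    using le_nonneg pair_cross_nonneg by (simp_all add: sum_nonneg)
  ultimately have S: "?S1 = 0" "?S2 = 0" "?S3 = 0" using le_nonneg[of v] by linarith+
  have one: "le u + cr v u = 1" if "u \<in> nb v" for u
    using S(1) contr finite_nb[OF v] that by (subst (asm) sum_nonneg_eq_0_iff) auto
  have far: "le u = 0" if "u \<in> U" "u \<noteq> v" "u \<notin> nb v" for u
    using S(2) le_nonneg finite_U that by (subst (asm) sum_nonneg_eq_0_iff) auto
  have cross0: "cr u w = 0" if "u \<in> U" "w \<in> nb u" "u \<noteq> v" "w \<noteq> v" for u w
  proof -
    have "{u, w} \<in> {e \<in> nb_pairs. v \<notin> e}" using that by (auto simp: nb_pairs_def)
    then have "pair_cross {u, w} = 0"
      using S(3) pair_cross_nonneg finite_nb_pairs by (subst (asm) sum_nonneg_eq_0_iff) auto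
    then show ?thesis by (simp add: pair_cross_pair)
  qed
  have zero_cases: "(\<forall>p<m. \<sigma> u p = 0) \<or> alt u" if "le u = 0" for u
    by (rule line_excess_zero_cases[OF odd_m signs that])
  have alt_zero: "2 \<le> cr u w" if "alt u" "\<forall>p<m. \<sigma> w p = 0" for u w
    using cross_alternating_zero[OF that(1), of "\<sigma> w"] alternating_minus_card[OF that(1) m_ge_3] that(2)
    by fastforce
  \<comment> \<open>Neither an empty nor an alternating cycle can avoid bad edges to the alternating
    \<open>u\<close>.\<close>
  have pos: "1 \<le> le w" if "alt u" "cr u w = 0" for u w
  proof (rule ccontr)
    assume "\<not> 1 \<le> le w"
    then have "le w = 0" using le_nonneg[of w] by linarith
    then show False
      using zero_cases[of w] alt_zero[OF that(1), of w] cross_alternating_alternating[OF that(1), of "\<sigma> w"] that(2)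
      by auto
  qed
  have nbU: "u \<in> U" "u \<noteq> v" if "u \<in> nb v" for u
    using nb_subset[OF v] nb_irrefl[of v] that by auto
  \<comment> \<open>Otherwise \<open>u\<close> is alternating with a single bad edge to
    \<open>v\<close>; a further neighbour \<open>w\<close> of \<open>u\<close> has positive excess,
    hence is adjacent to \<open>v\<close>, and the triangle forces \<open>w\<close> to have excess
    at least 3 instead of 1.\<close>
  have nb_pos: "le u = 1 \<and> cr v u = 0" if u: "u \<in> nb v" for u
  proof (rule ccontr)
    assume "\<not> ?thesis"
    then have cr1: "cr v u = 1" and le0: "le u = 0"
      using one[OF u] le_nonneg[of u] cross_nonneg[of m "\<sigma> v" "\<sigma> u"] by linarith+
    have altu: "alt u" using zero_cases[OF le0] alt_zero[OF altv, of u] cr1 by auto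
    obtain w where w: "w \<in> nb u" "w \<noteq> v" using nb_other[OF nbU(1)[OF u]] by blast
    have wU: "w \<in> U" using nb_subset[OF nbU(1)[OF u]] w by auto
    have uw: "cr u w = 0" using cross0 nbU[OF u] w by blast
    then have "1 \<le> le w" by (rule pos[OF altu])
    then have "w \<in> nb v" using far[OF wU w(2)] by auto
    then have vw: "cr v w = 0" "le w = 1"
      using one[of w] \<open>1 \<le> le w\<close> cross_nonneg[of m "\<sigma> v" "\<sigma> w"] by linarith+
    show False
      using triangle_two_alternating[OF altv altu m_ge_3 signs _ vw(1) uw] cr1 vw(2) by simp
  qed
  have "w \<notin> nb v \<and> nb w \<subseteq> nb v \<and> alt w \<and> cr w u = 0"
    if u: "u \<in> nb v" and w: "w \<in> nb u" "w \<noteq> v" for u w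
  proof -
    have wU: "w \<in> U" using nb_subset[OF nbU(1)[OF u]] w by auto
    have uw: "cr u w = 0" using cross0 nbU[OF u] w by blast
    \<comment> \<open>Adjacency of \<open>w\<close> and \<open>v\<close> would give a triangle in
      which \<open>u\<close> and \<open>w\<close> have total excess at least 3, yet each has
      1.\<close>
    have w_far: "w \<notin> nb v"
    proof
      assume w': "w \<in> nb v"
      have "3 \<le> le u + le w"
        using triangle_one_alternating[OF altv m_ge_3 signs signs signs] nb_pos[OF u] nb_pos[OF w'] uw
        by blast
      then show False using nb_pos[OF u] nb_pos[OF w'] by linarith
    qed
    \<comment> \<open>An empty \<open>w\<close> would leave \<open>u\<close> no \<open>-1\<close>,
      while \<open>u\<close> has a \<open>1\<close> opposite each of the at least two
      \<open>-1\<close> of \<open>v\<close>; its excess would be at least 2.\<close>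
    have "alt w"
    proof (rule ccontr)
      assume "\<not> alt w"
      then have "\<forall>p<m. \<sigma> w p = 0" using zero_cases far[OF wU w(2) w_far] by blast
      then have "{p. p < m \<and> \<sigma> u p = -1} = {}"
        using uw by (auto simp: cross_zero_iff bad_def)
      then have "minus_card m (\<sigma> u) = 0" by (metis card.empty of_nat_0)
      then have "plus_card m (\<sigma> u) \<le> le u"
        using line_excess_ge[of "\<sigma> u" m] sum_sign_seq[OF signs[of u], of m] by linarith
      moreover have "minus_card m (\<sigma> v) \<le> plus_card m (\<sigma> u)"
        using minus_card_le_plus_card[OF _ signs signs] nb_pos[OF u] by blast
      ultimately show False
        using alternating_minus_card[OF altv m_ge_3] nb_pos[OF u] by linarith
    qed
    \<comment> \<open>By \<open>pos\<close> every neighbour of \<open>w\<close> has positive excess,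
      and by \<open>far\<close> such a cycle is adjacent to \<open>v\<close>, unless it is
      \<open>v\<close>, which \<open>w_far\<close> excludes.\<close>
    moreover have "nb w \<subseteq> nb v"
    proof
      fix y assume y: "y \<in> nb w"
      have yU: "y \<in> U" using nb_subset[OF wU] y by auto
      have "y \<noteq> v" using y w_far nb_sym by blast
      then have "cr w y = 0" using cross0 wU y w by blast
      then have "1 \<le> le y" by (rule pos[OF \<open>alt w\<close>])
      then show "y \<in> nb v" using far[OF yU \<open>y \<noteq> v\<close>] by auto
    qed
    ultimately show ?thesis using w_far uw by (simp add: cross_commute)
  qed
  then show ?thesis using nb_pos by blast
qed

lemma tight_alternating_exists:
  assumes "x \<in> U" "p < m" "\<sigma> x p = -1" and tight: "total_excess \<le> 2 * int d"
  shows "\<exists>v\<in>U. (\<forall>u\<in>nb v. cr v u = 0) \<and>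
    (\<forall>u\<in>nb v. \<forall>w\<in>nb u. w \<noteq> v \<longrightarrow> w \<notin> nb v \<and> nb w \<subseteq> nb v \<and> cr w u = 0)"
proof -
  obtain v where "v \<in> U" "alt v"
    using total_excess_gt_no_alt[OF assms(1-3)] tight by (meson not_le)
  then show ?thesis using tight_structure[OF _ _ tight] by blast
qed

text \<open>Each \<open>-1\<close> of either cycle faces a \<open>1\<close> of the other. This
  serves to pair up the four cycles of the exceptional case.\<close>

lemma sum_pair_nonneg:
  assumes "cr v u = 0"
  shows "0 \<le> (\<Sum>p<m. \<sigma> v p) + (\<Sum>p<m. \<sigma> u p)"
  using minus_card_le_plus_card[OF assms signs signs]
    minus_card_le_plus_card[OF assms[unfolded cross_commute[of m "\<sigma> v"]] signs signs]
    sum_sign_seq[OF signs[of v], of m] sum_sign_seq[OF signs[of u], of m] by linarith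

end

section \<open>Boxes with cyclic adjacency\<close>

text \<open>The index set is left open because the quotient by direction 1 is the same kind of graph
  over \<open>{2..n}\<close>.\<close>

definition box :: "nat set \<Rightarrow> (nat \<Rightarrow> nat) \<Rightarrow> (nat \<Rightarrow> nat) set" where
  "box J k = (\<Pi>\<^sub>E i\<in>J. {x. x < k i})"

definition box_adj :: "nat set \<Rightarrow> (nat \<Rightarrow> nat) \<Rightarrow> (nat \<Rightarrow> nat) \<Rightarrow> (nat \<Rightarrow> nat) \<Rightarrow> bool" where
  "box_adj J k x y \<longleftrightarrow>
     (\<exists>i\<in>J. x i \<noteq> y i \<and> (\<forall>j\<in>J. j \<noteq> i \<longrightarrow> x j = y j) \<and>
        ([int (x i) - int (y i) = 1] (mod int (k i)) \<or>
         [int (x i) - int (y i) = - 1] (mod int (k i))))"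

definition box_nb :: "nat set \<Rightarrow> (nat \<Rightarrow> nat) \<Rightarrow> (nat \<Rightarrow> nat) \<Rightarrow> (nat \<Rightarrow> nat) set" where
  "box_nb J k x = {y. x \<in> box J k \<and> y \<in> box J k \<and> box_adj J k x y}"

definition cyc_step :: "nat \<Rightarrow> bool \<Rightarrow> nat \<Rightarrow> nat" where
  "cyc_step K b a = (if b then (if Suc a = K then 0 else Suc a) else (if a = 0 then K - 1 else a - 1))"

section \<open>Steps along a single cycle\<close>

lemma cyc_step_True: "a < K \<Longrightarrow> cyc_step K True a = Suc a mod K"
  by (auto simp: cyc_step_def)

lemma cyc_step_less: "3 \<le> K \<Longrightarrow> a < K \<Longrightarrow> cyc_step K b a < K"
  by (auto simp: cyc_step_def)

lemma cyc_step_neq: "3 \<le> K \<Longrightarrow> a < K \<Longrightarrow> cyc_step K b a \<noteq> a"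
  by (auto simp: cyc_step_def)

lemma cyc_step_inj: "3 \<le> K \<Longrightarrow> a < K \<Longrightarrow> cyc_step K b a = cyc_step K c a \<longleftrightarrow> b = c"
  by (auto simp: cyc_step_def split: if_splits)

lemma cong_diff_one_iff:
  assumes "a < K" "b < K"
  shows "[int a - int b = 1] (mod int K) \<longleftrightarrow> a = Suc b mod K"
proof -
  have "[int a - int b = 1] (mod int K) \<longleftrightarrow> [int a = int (Suc b)] (mod int K)"
    by (simp add: cong_iff_dvd_diff algebra_simps)
  also have "\<dots> \<longleftrightarrow> a = Suc b mod K"
    using assms by (simp only: cong_int_iff) (simp add: cong_def)
  finally show ?thesis .
qed

lemma cong_diff_minus_one_iff:
  assumes "a < K" "b < K"
  shows "[int a - int b = - 1] (mod int K) \<longleftrightarrow> b = Suc a mod K"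
proof -
  have "[int a - int b = - 1] (mod int K) \<longleftrightarrow> [int b - int a = 1] (mod int K)"
    by (metis (no_types, opaque_lifting) cong_minus_minus_iff minus_diff_eq minus_minus)
  then show ?thesis using cong_diff_one_iff assms by simp
qed

lemma cyclic_adj_iff:
  assumes "3 \<le> K" "a < K" "b < K"
  shows "a \<noteq> b \<and> ([int a - int b = 1] (mod int K) \<or> [int a - int b = - 1] (mod int K))
    \<longleftrightarrow> (\<exists>c. b = cyc_step K c a)"
proof -
  have "Suc b mod K = (if Suc b = K then 0 else Suc b)" "Suc a mod K = (if Suc a = K then 0 else Suc a)"
    using assms by auto
  then show ?thesis
    unfolding cong_diff_one_iff[OF assms(2,3)] cong_diff_minus_one_iff[OF assms(2,3)] ex_bool_eq
    using assms by (auto simp: cyc_step_def)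
qed

section \<open>Neighbourhoods in a box\<close>

lemma torus_adj_eq: "torus_adj n k = box_adj {1..n} k"
  by (simp add: torus_adj_def box_adj_def fun_eq_iff)

lemma torus_verts_eq: "torus_verts n k = box {1..n} k"
  by (simp add: torus_verts_def box_def)

lemma finite_box: "finite J \<Longrightarrow> finite (box J k)"
  unfolding box_def by (intro finite_PiE) auto

lemma boxD: "x \<in> box J k \<Longrightarrow> i \<in> J \<Longrightarrow> x i < k i"
  by (auto simp: box_def)

lemma box_eqI: "x \<in> box J k \<Longrightarrow> y \<in> box J k \<Longrightarrow> (\<And>i. i \<in> J \<Longrightarrow> x i = y i) \<Longrightarrow> x = y"
  unfolding box_def by (rule PiE_ext)

lemma box_fun_upd: "x \<in> box J k \<Longrightarrow> i \<in> J \<Longrightarrow> a < k i \<Longrightarrow> x(i := a) \<in> box J k"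
  unfolding box_def using PiE_fun_upd[of a "\<lambda>i. {x. x < k i}" i x J] by (simp add: insert_absorb)

lemma box_adj_commute: "box_adj J k x y \<longleftrightarrow> box_adj J k y x"
proof -
  have "[int a - int b = 1] (mod c) \<longleftrightarrow> [int b - int a = - 1] (mod c)" for a b c
    by (metis (no_types, opaque_lifting) cong_minus_minus_iff minus_diff_eq minus_minus)
  then show ?thesis unfolding box_adj_def by metis
qed

lemma box_nb_commute: "y \<in> box_nb J k x \<Longrightarrow> x \<in> box_nb J k y"
  using box_adj_commute by (auto simp: box_nb_def)

lemma box_nb_irrefl: "x \<notin> box_nb J k x"
  by (auto simp: box_nb_def box_adj_def)

lemma box_nb_eq:
  assumes "\<And>i. i \<in> J \<Longrightarrow> 3 \<le> k i" "x \<in> box J k"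
  shows "box_nb J k x = (\<lambda>(i, b). x(i := cyc_step (k i) b (x i))) ` (J \<times> UNIV)"
proof (intro equalityI subsetI)
  fix y assume "y \<in> box_nb J k x"
  then obtain i where i: "i \<in> J" "\<forall>j\<in>J. j \<noteq> i \<longrightarrow> x j = y j" and y: "y \<in> box J k"
    and "x i \<noteq> y i \<and> ([int (x i) - int (y i) = 1] (mod int (k i)) \<or>
         [int (x i) - int (y i) = - 1] (mod int (k i)))"
    by (auto simp: box_nb_def box_adj_def)
  then obtain b where b: "y i = cyc_step (k i) b (x i)"
    using cyclic_adj_iff[of "k i" "x i" "y i"] assms boxD by blast
  have "y = x(i := cyc_step (k i) b (x i))"
    using y i b assms box_fun_upd[OF assms(2) i(1)] boxD[OF y i(1)]
    by (intro box_eqI[OF y]) auto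
  then show "y \<in> (\<lambda>(i, b). x(i := cyc_step (k i) b (x i))) ` (J \<times> UNIV)" using i by auto
next
  fix y assume "y \<in> (\<lambda>(i, b). x(i := cyc_step (k i) b (x i))) ` (J \<times> UNIV)"
  then obtain i b where i: "i \<in> J" and y: "y = x(i := cyc_step (k i) b (x i))" by auto
  have lt: "x i < k i" "cyc_step (k i) b (x i) < k i"
    using assms i boxD cyc_step_less by auto
  then have "y \<in> box J k" using y box_fun_upd[OF assms(2) i] by simp
  moreover have "x i \<noteq> y i \<and> ([int (x i) - int (y i) = 1] (mod int (k i)) \<or>
         [int (x i) - int (y i) = - 1] (mod int (k i)))"
    using cyclic_adj_iff[of "k i" "x i" "y i"] lt assms(1)[OF i] y by auto
  ultimately show "y \<in> box_nb J k x"
    using y i assms(2) unfolding box_nb_def box_adj_def by auto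
qed

text \<open>A neighbour reveals its coordinate, the only one that changes, and then its direction,
  since the two directions differ on cycles of length at least 3.\<close>

lemma card_box_nb:
  assumes "finite J" "\<And>i. i \<in> J \<Longrightarrow> 3 \<le> k i" "x \<in> box J k"
  shows "card (box_nb J k x) = 2 * card J"
proof -
  have "inj_on (\<lambda>(i, b). x(i := cyc_step (k i) b (x i))) (J \<times> UNIV)"
  proof (rule inj_onI, clarify)
    fix i b i' b'
    assume i: "i \<in> J" "i' \<in> J" and eq: "x(i := cyc_step (k i) b (x i)) = x(i' := cyc_step (k i') b' (x i'))"
    have neq: "cyc_step (k i) b (x i) \<noteq> x i"
      using i boxD[OF assms(3)] assms(2) cyc_step_neq by blast
    have "i = i'"
    proof (rule ccontr)
      assume "i \<noteq> i'"
      then show False using fun_cong[OF eq, of i] neq by simp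
    qed
    moreover from this have "b = b'"
      using fun_cong[OF eq, of i] cyc_step_inj[of "k i" "x i" b b'] assms(2)[OF i(1)] boxD[OF assms(3) i(1)]
      by simp
    ultimately show "i = i' \<and> b = b'" by simp
  qed
  then have "card (box_nb J k x) = card (J \<times> (UNIV :: bool set))"
    using box_nb_eq[of J k x] assms(2,3) by (simp add: card_image)
  then show ?thesis by (simp add: card_cartesian_product)
qed

lemma box_nb_updI:
  assumes "\<And>i. i \<in> J \<Longrightarrow> 3 \<le> k i" "x \<in> box J k" "i \<in> J"
  shows "x(i := cyc_step (k i) b (x i)) \<in> box_nb J k x"
proof -
  have "(i, b) \<in> J \<times> UNIV" using assms(3) by simp
  then have "(\<lambda>(i, b). x(i := cyc_step (k i) b (x i))) (i, b) \<in> box_nb J k x"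
    using box_nb_eq[of J k x] assms(1,2) by blast
  then show ?thesis by simp
qed

lemma box_nbE:
  assumes "y \<in> box_nb J k x" "\<And>i. i \<in> J \<Longrightarrow> 3 \<le> k i"
  obtains i b where "i \<in> J" "y = x(i := cyc_step (k i) b (x i))"
proof -
  have "x \<in> box J k" using assms(1) by (simp add: box_nb_def)
  then have "y \<in> (\<lambda>(i, b). x(i := cyc_step (k i) b (x i))) ` (J \<times> UNIV)"
    using box_nb_eq[of J k x] assms by blast
  then show thesis using that by auto
qed

lemma uverts_torus: "uverts (torus n k) = box {1..n} k"
  by (simp add: torus_def torus_verts_eq)

lemma uedges_torus: "uedges (torus n k) = {{x, y} | x y. y \<in> box_nb {1..n} k x}"
  by (auto simp: torus_def torus_verts_eq torus_adj_eq box_nb_def)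

lemma simple_graph_torus: "simple_graph (torus n k)"
proof -
  have "x \<in> box J k" "y \<in> box J k" "x \<noteq> y" if "y \<in> box_nb J k x" for x y J
    using that by (auto simp: box_nb_def box_adj_def)
  then show ?thesis
    unfolding simple_graph_def uverts_torus uedges_torus by (fastforce simp: finite_box)
qed

lemma torus_edges_at:
  assumes "\<And>i. i \<in> {1..n} \<Longrightarrow> 3 \<le> k i" "v \<in> box {1..n} k"
  shows "card {e \<in> uedges (torus n k). v \<in> e} \<le> 2 * n"
proof -
  have sub: "{e \<in> uedges (torus n k). v \<in> e} \<subseteq> (\<lambda>w. {v, w}) ` box_nb {1..n} k v"
    using box_nb_commute by (auto simp: uedges_torus)
  have "finite (box_nb {1..n} k v)"
    by (rule finite_subset[OF _ finite_box[of "{1..n}" k]]) (auto simp: box_nb_def)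
  from surj_card_le[OF this sub] show ?thesis
    using card_box_nb[of "{1..n}" k v] assms by simp
qed

section \<open>Expansion of the torus\<close>

definition bad_edges :: "nat \<Rightarrow> (nat \<Rightarrow> nat) \<Rightarrow> (nat \<Rightarrow> nat) set \<Rightarrow> (nat \<Rightarrow> nat) set \<Rightarrow> (nat \<Rightarrow> nat) set set" where
  "bad_edges n k I Q = {e \<in> uedges (torus n k). e \<inter> I \<noteq> {} \<and> e \<inter> Q = {}}"

definition indicator_sign :: "'a set \<Rightarrow> 'a set \<Rightarrow> 'a \<Rightarrow> int" where
  "indicator_sign I Q x = (if x \<in> I then -1 else if x \<in> Q then 1 else 0)"

lemma sum_indicator_sign:
  assumes "finite V" "I \<subseteq> V" "Q \<subseteq> V" "I \<inter> Q = {}"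
  shows "(\<Sum>x\<in>V. indicator_sign I Q x) = int (card Q) - int (card I)"
proof -
  have fin: "finite I" "finite Q" using assms by (auto intro: finite_subset)
  have "(\<Sum>x\<in>V. indicator_sign I Q x) = (\<Sum>x\<in>I \<union> Q. indicator_sign I Q x)"
    using assms by (intro sum.mono_neutral_right) (auto simp: indicator_sign_def)
  also have "\<dots> = (\<Sum>x\<in>I. indicator_sign I Q x) + (\<Sum>x\<in>Q. indicator_sign I Q x)"
    using assms fin by (intro sum.union_disjoint) auto
  also have "(\<Sum>x\<in>I. indicator_sign I Q x) = (\<Sum>x\<in>I. -1)"
    by (intro sum.cong) (auto simp: indicator_sign_def)
  also have "(\<Sum>x\<in>Q. indicator_sign I Q x) = (\<Sum>x\<in>Q. 1)"
    using assms(4) by (intro sum.cong) (auto simp: indicator_sign_def)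
  finally show ?thesis by simp
qed

lemma bad_edge_indicator_sign:
  assumes "I \<inter> Q = {}"
  shows "(-1 \<in> indicator_sign I Q ` e \<and> 1 \<notin> indicator_sign I Q ` e) \<longleftrightarrow> e \<inter> I \<noteq> {} \<and> e \<inter> Q = {}"
proof -
  have "-1 = indicator_sign I Q x \<longleftrightarrow> x \<in> I" "1 = indicator_sign I Q x \<longleftrightarrow> x \<in> Q" for x
    using assms by (auto simp: indicator_sign_def)
  then show ?thesis by (auto simp: image_iff)
qed

context
  fixes n :: nat and k :: "nat \<Rightarrow> nat"
  assumes n: "n \<ge> 2" and k: "\<And>i. i \<in> {1..n} \<Longrightarrow> k i \<ge> 3" and odd: "odd (k 1)"
begin

section \<open>Cutting the torus into cycles in direction 1\<close>

lemma insert_dims: "insert 1 {2..n} = {1..n}"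
  using n by auto

lemma box_insert_eq:
  "box {1..n} k = (\<lambda>(p, u). u(1 := p)) ` ({..<k 1} \<times> box {2..n} k)"
  unfolding box_def insert_dims[symmetric] PiE_insert_eq by (simp add: lessThan_def)

lemma inj_on_box_insert:
  "inj_on (\<lambda>(p, u). u(1 := p)) ({..<k 1} \<times> box {2..n} k)"
  using inj_combinator[of 1 "{2..n}" "\<lambda>i. {x. x < k i}"] by (simp add: box_def lessThan_def)

lemma lift_in_box: "p < k 1 \<Longrightarrow> u \<in> box {2..n} k \<Longrightarrow> u(1 := p) \<in> box {1..n} k"
  unfolding box_insert_eq by force

text \<open>A vertex of the quotient is extensional on \<open>{2..n}\<close>, so its value at 1 is
  \<open>undefined\<close>; resetting that coordinate recovers it.\<close>

lemma lift_restrict: "u \<in> box {2..n} k \<Longrightarrow> (u(1 := p))(1 := undefined) = u"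
  using PiE_arb[of u "{2..n}" _ 1] by (auto simp: box_def fun_eq_iff)

lemma lift_edge_line:
  assumes "u \<in> box {2..n} k" "p < k 1"
  shows "{u(1 := p), u(1 := Suc p mod k 1)} \<in> uedges (torus n k)"
proof -
  have one: "1 \<in> {1..n}" using n by simp
  have "u(1 := p) \<in> box {1..n} k" using lift_in_box assms by simp
  from box_nb_updI[OF k this one, of True]
  have "u(1 := Suc p mod k 1) \<in> box_nb {1..n} k (u(1 := p))"
    using assms(2) by (simp add: cyc_step_True)
  then show ?thesis unfolding uedges_torus by blast
qed

lemma lift_edge_cross:
  assumes "w \<in> box_nb {2..n} k u" "p < k 1"
  shows "{u(1 := p), w(1 := p)} \<in> uedges (torus n k)"
proof -
  obtain i where i: "i \<in> {2..n}" "u i \<noteq> w i" "\<forall>j\<in>{2..n}. j \<noteq> i \<longrightarrow> u j = w j"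
    "[int (u i) - int (w i) = 1] (mod int (k i)) \<or> [int (u i) - int (w i) = - 1] (mod int (k i))"
    using assms(1) by (auto simp: box_nb_def box_adj_def)
  have i1: "i \<in> {1..n}" "i \<noteq> 1" using i(1) by auto
  have "\<forall>j\<in>{1..n}. j \<noteq> i \<longrightarrow> (u(1 := p)) j = (w(1 := p)) j"
    using i(3) by auto
  then have "box_adj {1..n} k (u(1 := p)) (w(1 := p))"
    unfolding box_adj_def using i(2,4) i1 by (intro bexI[of _ i]) auto
  then have "w(1 := p) \<in> box_nb {1..n} k (u(1 := p))"
    using assms lift_in_box by (auto simp: box_nb_def)
  then show ?thesis unfolding uedges_torus by blast
qed

lemma line_system_torus:
  assumes "\<And>u. sign_seq (\<sigma> u)"
  shows "line_system (box {2..n} k) (box_nb {2..n} k) (k 1) (n - 1) \<sigma>"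
proof
  show "finite (box {2..n} k)" by (simp add: finite_box)
  show "box_nb {2..n} k u \<subseteq> box {2..n} k" if "u \<in> box {2..n} k" for u
    by (auto simp: box_nb_def)
  show "u \<notin> box_nb {2..n} k u" for u by (rule box_nb_irrefl)
  show "u \<in> box_nb {2..n} k w" if "w \<in> box_nb {2..n} k u" for u w
    using that by (rule box_nb_commute)
  show "2 * (n - 1) \<le> card (box_nb {2..n} k u)" if "u \<in> box {2..n} k" for u
    using card_box_nb[of "{2..n}" k u] k that by simp
  show "1 \<le> n - 1" using n by simp
  show "odd (k 1)" by (rule odd)
  show "3 \<le> k 1" using k[of 1] n by simp
  show "sign_seq (\<sigma> u)" for u by (rule assms)
qed


context
  fixes I Q :: "(nat \<Rightarrow> nat) set"
  assumes I: "I \<subseteq> box {1..n} k" and Q: "Q \<subseteq> box {1..n} k" and IQ: "I \<inter> Q = {}"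
begin

definition line_sign :: "(nat \<Rightarrow> nat) \<Rightarrow> nat \<Rightarrow> int" where
  "line_sign u p = indicator_sign I Q (u(1 := p))"

lemma sign_seq_line_sign: "sign_seq (line_sign u)"
  by (auto simp: sign_seq_def line_sign_def indicator_sign_def)

interpretation line_system "box {2..n} k" "box_nb {2..n} k" "k 1" "n - 1" line_sign
  by (rule line_system_torus[OF sign_seq_line_sign])

lemma sum_line_sign:
  "(\<Sum>u\<in>box {2..n} k. \<Sum>p<k 1. line_sign u p) = int (card Q) - int (card I)"
proof -
  have "(\<Sum>u\<in>box {2..n} k. \<Sum>p<k 1. line_sign u p)
      = (\<Sum>p<k 1. \<Sum>u\<in>box {2..n} k. line_sign u p)"
    by (rule sum.swap)
  also have "\<dots> = (\<Sum>(p, u)\<in>{..<k 1} \<times> box {2..n} k. line_sign u p)"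
    by (rule sum.cartesian_product)
  also have "\<dots> = (\<Sum>x\<in>box {1..n} k. indicator_sign I Q x)"
    unfolding box_insert_eq sum.reindex[OF inj_on_box_insert]
    by (intro sum.cong) (auto simp: line_sign_def)
  also have "\<dots> = int (card Q) - int (card I)"
    by (rule sum_indicator_sign[OF _ I Q IQ]) (simp add: finite_box)
  finally show ?thesis .
qed

lemma bad_iff: "bad (indicator_sign I Q x) (indicator_sign I Q y) \<longleftrightarrow> {x, y} \<inter> I \<noteq> {} \<and> {x, y} \<inter> Q = {}"
  using bad_edge_indicator_sign[OF IQ, of "{x, y}"] by (auto simp: bad_def)

text \<open>Bad edges inside cycles (\<open>?S1\<close>) and between cycles (\<open>?S2\<close>)
  embed disjointly into the bad edges of the torus: coordinate 1 reveals the position, and erasing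
  it reveals the quotient vertex or pair.\<close>

lemma total_excess_le:
  "total_excess \<le> int (card Q) - int (card I) + int (card (bad_edges n k I Q))"
proof -
  let ?U = "box {2..n} k" and ?m = "k 1"
  let ?f1 = "\<lambda>(u, p). {u(1 := p), u(1 := Suc p mod ?m)}"
  let ?f2 = "\<lambda>(e, p). (\<lambda>u. u(1 := p)) ` e"
  let ?S1 = "SIGMA u:?U. {p. p < ?m \<and> bad (line_sign u p) (line_sign u (Suc p mod ?m))}"
  let ?S2 = "SIGMA e:nb_pairs. {p. p < ?m \<and> -1 \<in> (\<lambda>u. line_sign u p) ` e \<and> 1 \<notin> (\<lambda>u. line_sign u p) ` e}"
  have finS: "finite ?S1" "finite ?S2"
    using finite_U finite_nb_pairs by auto
  have coord1: "(\<lambda>x. x 1) ` ?f1 (u, p) = {p, Suc p mod ?m}"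
      "(\<lambda>x. x(1 := undefined)) ` ?f1 (u, p) = {u}" if "u \<in> ?U" for u p
    using lift_restrict[OF that] by auto
  have pairE: "e \<subseteq> ?U" "e \<noteq> {}" if "e \<in> nb_pairs" for e
    using that by (auto simp: nb_pairs_def box_nb_def)
  have coord2: "(\<lambda>x. x 1) ` ?f2 (e, p) = {p}" "(\<lambda>x. x(1 := undefined)) ` ?f2 (e, p) = e"
    if "e \<in> nb_pairs" for e p
  proof -
    show "(\<lambda>x. x 1) ` ?f2 (e, p) = {p}" using pairE[OF that] by (auto simp: image_image)
    have "(\<lambda>x. x(1 := undefined)) ` ?f2 (e, p) = (\<lambda>u. u) ` e"
      unfolding prod.case image_image using pairE(1)[OF that] lift_restrict by (intro image_cong) auto
    then show "(\<lambda>x. x(1 := undefined)) ` ?f2 (e, p) = e" by simp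
  qed
  have succ: "Suc p mod ?m = (if Suc p = ?m then 0 else Suc p)" if "p < ?m" for p
    using that by auto
  have inj1: "inj_on ?f1 ?S1"
  proof (rule inj_onI)
    fix a b assume ab: "a \<in> ?S1" "b \<in> ?S1" "?f1 a = ?f1 b"
    obtain u p w q where pairs: "a = (u, p)" "b = (w, q)" by (cases a, cases b)
    have uw: "u \<in> ?U" "w \<in> ?U" "p < ?m" "q < ?m" using ab(1,2) pairs by auto
    have f: "?f1 (u, p) = ?f1 (w, q)" using ab(3) unfolding pairs .
    have "{p, Suc p mod ?m} = {q, Suc q mod ?m}"
      using arg_cong[OF f, of "image (\<lambda>x. x 1)"] unfolding coord1(1)[OF uw(1)] coord1(1)[OF uw(2)] .
    \<comment> \<open>On a cycle of length at least 3 an edge determines its starting point.\<close>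
    then have "p = q"
      using m_ge_3 uw(3,4) unfolding succ[OF uw(3)] succ[OF uw(4)] by (auto simp: doubleton_eq_iff split: if_splits)
    moreover have "{u} = {w}"
      using arg_cong[OF f, of "image (\<lambda>x. x(1 := undefined))"]
      unfolding coord1(2)[OF uw(1)] coord1(2)[OF uw(2)] .
    ultimately show "a = b" using pairs by simp
  qed
  have inj2: "inj_on ?f2 ?S2"
  proof (rule inj_onI)
    fix a b assume ab: "a \<in> ?S2" "b \<in> ?S2" "?f2 a = ?f2 b"
    obtain e p e' q where pairs: "a = (e, p)" "b = (e', q)" by (cases a, cases b)
    have ee: "e \<in> nb_pairs" "e' \<in> nb_pairs" using ab(1,2) pairs by auto
    have f: "?f2 (e, p) = ?f2 (e', q)" using ab(3) unfolding pairs .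
    have "{p} = {q}"
      using arg_cong[OF f, of "image (\<lambda>x. x 1)"] unfolding coord2(1)[OF ee(1)] coord2(1)[OF ee(2)] .
    moreover have "e = e'"
      using arg_cong[OF f, of "image (\<lambda>x. x(1 := undefined))"]
      unfolding coord2(2)[OF ee(1)] coord2(2)[OF ee(2)] .
    ultimately show "a = b" using pairs by simp
  qed
  \<comment> \<open>Only an edge along a cycle takes two values in coordinate 1.\<close>
  have disj: "?f1 ` ?S1 \<inter> ?f2 ` ?S2 = {}"
  proof (rule equals0I)
    fix y assume y: "y \<in> ?f1 ` ?S1 \<inter> ?f2 ` ?S2"
    from IntD1[OF y] obtain a where a: "y = ?f1 a" "a \<in> ?S1" by (rule imageE)
    from IntD2[OF y] obtain b where b: "y = ?f2 b" "b \<in> ?S2" by (rule imageE)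
    have ab: "a \<in> ?S1" "b \<in> ?S2" "?f1 a = ?f2 b" using a b by (simp_all only:)
    obtain u p e q where pairs: "a = (u, p)" "b = (e, q)" by (cases a, cases b)
    have u: "u \<in> ?U" and e: "e \<in> nb_pairs" and p: "p < ?m" using ab(1,2) pairs by auto
    have f: "?f1 (u, p) = ?f2 (e, q)" using ab(3) unfolding pairs .
    have "{p, Suc p mod ?m} = {q}"
      using arg_cong[OF f, of "image (\<lambda>x. x 1)"] unfolding coord1(1)[OF u] coord2(1)[OF e] .
    then have "Suc p mod ?m = p" by auto
    then show False using succ[OF p] m_ge_3 by (auto split: if_splits)
  qed
  have sub1: "?f1 ` ?S1 \<subseteq> bad_edges n k I Q"
  proof
    fix e assume "e \<in> ?f1 ` ?S1"
    then obtain u p where e: "e = {u(1 := p), u(1 := Suc p mod ?m)}" and u: "u \<in> ?U" "p < ?m"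
      and b: "bad (line_sign u p) (line_sign u (Suc p mod ?m))" by auto
    have "e \<inter> I \<noteq> {} \<and> e \<inter> Q = {}" using b unfolding line_sign_def bad_iff e .
    moreover have "e \<in> uedges (torus n k)" unfolding e by (rule lift_edge_line[OF u])
    ultimately show "e \<in> bad_edges n k I Q" by (simp add: bad_edges_def)
  qed
  have sub2: "?f2 ` ?S2 \<subseteq> bad_edges n k I Q"
  proof
    fix e assume "e \<in> ?f2 ` ?S2"
    then obtain e' p where e: "e = (\<lambda>u. u(1 := p)) ` e'" and e': "e' \<in> nb_pairs" and p: "p < ?m"
      and b: "-1 \<in> (\<lambda>u. line_sign u p) ` e'" "1 \<notin> (\<lambda>u. line_sign u p) ` e'" by auto
    have im: "(\<lambda>u. line_sign u p) ` e' = indicator_sign I Q ` e"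
      unfolding e image_image line_sign_def ..
    have "e \<inter> I \<noteq> {} \<and> e \<inter> Q = {}"
      using b bad_edge_indicator_sign[OF IQ, of e] unfolding im by blast
    moreover obtain u w where "e' = {u, w}" "w \<in> box_nb {2..n} k u"
      using e' by (auto simp: nb_pairs_def)
    then have "e \<in> uedges (torus n k)" using lift_edge_cross[OF _ p] e by simp
    ultimately show "e \<in> bad_edges n k I Q" by (simp add: bad_edges_def)
  qed
  have finB: "finite (bad_edges n k I Q)"
    unfolding bad_edges_def using finite_uedges[OF simple_graph_torus] by simp
  have "card ?S1 + card ?S2 = card (?f1 ` ?S1 \<union> ?f2 ` ?S2)"
    using finS disj by (simp only: card_Un_disjoint finite_imageI card_image[OF inj1] card_image[OF inj2])
  also have "\<dots> \<le> card (bad_edges n k I Q)"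
    using sub1 sub2 finB by (intro card_mono) auto
  finally have le: "int (card ?S1) + int (card ?S2) \<le> int (card (bad_edges n k I Q))"
    by linarith
  have "int (card ?S1) = (\<Sum>u\<in>?U. int (card {p. p < ?m \<and> bad (line_sign u p) (line_sign u (Suc p mod ?m))}))"
    using finite_U by (subst card_SigmaI) auto
  moreover have "int (card ?S2) = (\<Sum>e\<in>nb_pairs. pair_cross e)"
    unfolding pair_cross_def using finite_nb_pairs by (subst card_SigmaI) auto
  ultimately show ?thesis
    using le sum_line_sign unfolding total_excess_def line_excess_def sum.distrib by linarith
qed

text \<open>The witness \<open>w\<close> lies two steps from \<open>v\<close> in direction 2. All
  its neighbours must be neighbours of \<open>v\<close>, which fails for a step in another
  direction, and for a third step in direction 2 unless that cycle has length 4.\<close>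

lemma tight_torus:
  assumes v: "v \<in> box {2..n} k"
    and far: "\<And>u w. u \<in> box_nb {2..n} k v \<Longrightarrow> w \<in> box_nb {2..n} k u \<Longrightarrow> w \<noteq> v \<Longrightarrow>
       w \<notin> box_nb {2..n} k v \<and> box_nb {2..n} k w \<subseteq> box_nb {2..n} k v"
  shows "n = 2 \<and> k 2 = 4"
proof -
  let ?J = "{2..n}"
  let ?nx = "cyc_step (k 2) True"
  have kJ: "\<And>i. i \<in> ?J \<Longrightarrow> 3 \<le> k i" using k by auto
  have two: "2 \<in> ?J" using n by simp
  have K: "3 \<le> k 2" "v 2 < k 2" using kJ[OF two] boxD[OF v two] by auto
  define a where "a = v(2 := ?nx (v 2))"
  define w where "w = a(2 := ?nx (a 2))"
  have a: "a \<in> box_nb ?J k v" unfolding a_def by (rule box_nb_updI[OF kJ v two])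
  then have aV: "a \<in> box ?J k" by (simp add: box_nb_def)
  have w: "w \<in> box_nb ?J k a" unfolding w_def by (rule box_nb_updI[OF kJ aV two])
  then have wV: "w \<in> box ?J k" by (simp add: box_nb_def)
  have w2: "w 2 = ?nx (?nx (v 2))" by (simp add: w_def a_def)
  have w2v: "w 2 \<noteq> v 2" using K by (auto simp: w2 cyc_step_def split: if_splits)
  then have wv: "w \<noteq> v" by auto
  have w_sub: "w \<notin> box_nb ?J k v" "box_nb ?J k w \<subseteq> box_nb ?J k v"
    using far[OF a w wv] by auto
  \<comment> \<open>A step from \<open>w\<close> in direction 3 would differ from \<open>v\<close>
    in two coordinates.\<close>
  have n2: "n = 2"
  proof (rule ccontr)
    assume "n \<noteq> 2"
    then have three: "3 \<in> ?J" using n by simp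
    let ?y = "w(3 := cyc_step (k 3) True (w 3))"
    have "?y \<in> box_nb ?J k v" using box_nb_updI[OF kJ wV three] w_sub by blast
    then obtain i where "\<forall>j\<in>?J. j \<noteq> i \<longrightarrow> v j = ?y j"
      by (auto simp: box_nb_def box_adj_def)
    moreover have "v 2 \<noteq> ?y 2" using w2v by simp
    moreover have "w 3 = v 3" by (simp add: w_def a_def)
    then have "v 3 \<noteq> ?y 3"
      using cyc_step_neq[OF kJ[OF three] boxD[OF v three], of True] by simp
    ultimately show False using two three by (metis numeral_eq_iff num.distinct(5))
  qed
  let ?y = "w(2 := ?nx (w 2))"
  have "?y \<in> box_nb ?J k v" using box_nb_updI[OF kJ wV two] w_sub by blast
  then obtain i b where "i \<in> ?J" and y: "?y = v(i := cyc_step (k i) b (v i))"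
    by (rule box_nbE[OF _ kJ])
  then have "i = 2" using n2 by simp
  then have "?y 2 = cyc_step (k 2) b (v 2)" using fun_cong[OF y, of 2] by simp
  then have b: "?nx (?nx (?nx (v 2))) = cyc_step (k 2) b (v 2)" by (simp add: w2)
  \<comment> \<open>This excludes length 3, where two steps forward equal one step back.\<close>
  have "w 2 \<noteq> cyc_step (k 2) False (v 2)"
  proof
    assume "w 2 = cyc_step (k 2) False (v 2)"
    then have "w = v(2 := cyc_step (k 2) False (v 2))" by (simp add: w_def a_def)
    then show False using w_sub(1) box_nb_updI[OF kJ v two, of False] by simp
  qed
  \<comment> \<open>Three steps forward equal one step in some direction, so \<open>k 2\<close>
    divides 2 or 4.\<close>
  then have "k 2 = 4"
    using b K unfolding w2 by (cases b) (auto simp: cyc_step_def split: if_splits)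
  then show ?thesis using n2 by simp
qed

text \<open>If the total excess exceeds its lower bound, the first alternative follows. Otherwise
  the quotient is a 4-cycle, which splits into two pairs of adjacent cycles, each pair with
  nonnegative sign sum.\<close>

lemma torus_expansion:
  assumes "I \<noteq> {}"
  shows "card I + 2 * n \<le> card Q + card (bad_edges n k I Q) + 1 \<or>
    n = 2 \<and> k 2 = 4 \<and> card I \<le> card Q \<and> card I + 2 \<le> card Q + card (bad_edges n k I Q)"
proof -
  let ?J = "{2..n}"
  obtain x where x: "x \<in> I" using assms by auto
  then obtain p u where u: "u \<in> box ?J k" "p < k 1" and "x = u(1 := p)"
    using I unfolding box_insert_eq by auto
  then have minus: "line_sign u p = -1" using x by (simp add: line_sign_def indicator_sign_def)
  have ge: "2 * int (n - 1) \<le> total_excess" by (rule total_excess_ge[OF u minus])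
  show ?thesis
  proof (cases "total_excess \<le> 2 * int (n - 1)")
    case False
    then show ?thesis using total_excess_le n by linarith
  next
    case True
    obtain v where v: "v \<in> box ?J k" and tight: "(\<forall>u\<in>box_nb ?J k v. cr v u = 0) \<and>
       (\<forall>u\<in>box_nb ?J k v. \<forall>w\<in>box_nb ?J k u. w \<noteq> v \<longrightarrow>
         w \<notin> box_nb ?J k v \<and> box_nb ?J k w \<subseteq> box_nb ?J k v \<and> cr w u = 0)"
      using tight_alternating_exists[OF u minus True] by (rule bexE)
    have cr0: "cr v u = 0" if "u \<in> box_nb ?J k v" for u
      using tight that by blast
    have far: "w \<notin> box_nb ?J k v \<and> box_nb ?J k w \<subseteq> box_nb ?J k v \<and> cr w u = 0"
      if "u \<in> box_nb ?J k v" "w \<in> box_nb ?J k u" "w \<noteq> v" for u w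
      using tight that by blast
    have n2: "n = 2" and k2: "k 2 = 4" using tight_torus[OF v] far by blast+
    have kJ: "\<And>i. i \<in> ?J \<Longrightarrow> 3 \<le> k i" using k by auto
    have two: "2 \<in> ?J" using n by simp
    let ?nx = "cyc_step 4 True"
    define f where "f j = (\<Sum>p<k 1. line_sign (v(2 := j)) p)" for j
    have inB: "v(2 := j) \<in> box ?J k" if "j < 4" for j
      using box_fun_upd[OF v two, of j] that k2 by simp
    have nbB: "v(2 := ?nx j) \<in> box_nb ?J k (v(2 := j))" if "j < 4" for j
      using box_nb_updI[OF kJ inB[OF that] two, of True] k2 by simp
    have v2: "v 2 < 4" using boxD[OF v two] k2 by simp
    \<comment> \<open>The remaining vertices of the quotient 4-cycle, in cyclic order after
      \<open>v 2\<close>.\<close>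
    define a b c where "a = ?nx (v 2)" "b = ?nx a" "c = ?nx b"
    have lt: "a < 4" "b < 4" "c < 4" and bv: "b \<noteq> v 2"
      using v2 by (auto simp: a_b_c_def cyc_step_def)
    have va: "v(2 := a) \<in> box_nb ?J k v" using nbB[OF v2] by (simp add: a_b_c_def)
    have ab: "v(2 := b) \<in> box_nb ?J k (v(2 := a))" using nbB[OF lt(1)] by (simp add: a_b_c_def)
    have bc: "v(2 := c) \<in> box_nb ?J k (v(2 := b))" using nbB[OF lt(2)] by (simp add: a_b_c_def)
    have bv': "v(2 := b) \<noteq> v" using bv by (metis fun_upd_same)
    have "v(2 := c) \<in> box_nb ?J k v" using far[OF va ab bv'] bc by blast
    \<comment> \<open>\<open>far\<close> is applied with \<open>c\<close> as the neighbour of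
      \<open>v\<close> and \<open>b\<close> as the vertex at distance 2.\<close>
    then have "cr (v(2 := b)) (v(2 := c)) = 0"
      using far[OF _ box_nb_commute[OF bc] bv'] by blast
    then have "0 \<le> f b + f c" using sum_pair_nonneg by (simp add: f_def)
    moreover have "0 \<le> f (v 2) + f a" using sum_pair_nonneg[OF cr0[OF va]] by (simp add: f_def)
    moreover have "f (v 2) + f a + f b + f c = f 0 + f 1 + f 2 + f 3"
    proof -
      consider "v 2 = 0" | "v 2 = 1" | "v 2 = 2" | "v 2 = 3" using v2 by linarith
      then show ?thesis by cases (simp_all add: a_b_c_def cyc_step_def numeral_eq_Suc)
    qed
    moreover have "(\<Sum>u\<in>box ?J k. \<Sum>p<k 1. line_sign u p) = f 0 + f 1 + f 2 + f 3"
    proof -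
      have J2: "?J = {2}" using n2 by auto
      have "box ?J k = (\<lambda>j. v(2 := j)) ` {..<4}"
      proof (intro equalityI subsetI)
        fix x assume x: "x \<in> box ?J k"
        then have "x = v(2 := x 2)"
          by (intro box_eqI[OF x inB]) (use boxD[OF x two] k2 J2 in auto)
        then show "x \<in> (\<lambda>j. v(2 := j)) ` {..<4}"
          using boxD[OF x two] k2 by auto
      qed (use inB in auto)
      moreover have "inj_on (\<lambda>j. v(2 := j)) {..<4}" by (metis fun_upd_same inj_onI)
      ultimately have "(\<Sum>u\<in>box ?J k. \<Sum>p<k 1. line_sign u p) = (\<Sum>j<4. f j)"
        by (simp add: sum.reindex f_def)
      then show ?thesis by (simp add: numeral_eq_Suc)
    qed
    ultimately have "card I \<le> card Q" using sum_line_sign by linarith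
    then show ?thesis using ge total_excess_le n2 k2 by simp
  qed
qed

end

end

section \<open>Deletion from the torus\<close>

lemma fmp_le:
  assumes "F \<subseteq> uedges G" "finite F" "\<not> has_fpm (delete G {} F)"
  shows "fmp G \<le> card F"
  unfolding fmp_def using assms by (intro Least_le) blast

lemma fsmp_le:
  assumes "F \<subseteq> uverts G <+> uedges G" "finite F" "\<not> has_fpm (delete G (Inl -` F) (Inr -` F))"
  shows "fsmp G \<le> card F"
  unfolding fsmp_def using assms by (intro Least_le) blast

text \<open>\<open>F0\<close> witnesses that the minimum ranges over a nonempty set, so
  \<open>LEAST\<close> is attained.\<close>

lemma fmp_ge:
  assumes "F0 \<subseteq> uedges G" "finite F0" "\<not> has_fpm (delete G {} F0)"
    and "\<And>F. F \<subseteq> uedges G \<Longrightarrow> finite F \<Longrightarrow> \<not> has_fpm (delete G {} F) \<Longrightarrow> c \<le> card F"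
  shows "c \<le> fmp G"
  unfolding fmp_def
  by (rule LeastI2_ex) (use assms in blast)+

lemma fsmp_ge:
  assumes "F0 \<subseteq> uverts G <+> uedges G" "finite F0" "\<not> has_fpm (delete G (Inl -` F0) (Inr -` F0))"
    and "\<And>F. F \<subseteq> uverts G <+> uedges G \<Longrightarrow> finite F \<Longrightarrow>
      \<not> has_fpm (delete G (Inl -` F) (Inr -` F)) \<Longrightarrow> c \<le> card F"
  shows "c \<le> fsmp G"
  unfolding fsmp_def
  by (rule LeastI2_ex) (use assms in blast)+

lemma not_has_fpm_isolated:
  assumes "v \<in> uverts G"
  shows "\<not> has_fpm (delete G {} {e \<in> uedges G. v \<in> e})"
proof
  assume "has_fpm (delete G {} {e \<in> uedges G. v \<in> e})" (is "has_fpm ?G")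
  then obtain g where "fractional_perfect_matching ?G g" by (auto simp: has_fpm_def)
  moreover have "v \<in> uverts ?G" using assms by (simp add: delete_def)
  ultimately have "(\<Sum>e\<in>{e \<in> uedges ?G. v \<in> e}. g e) = 1"
    unfolding fractional_perfect_matching_def by blast
  moreover have "{e \<in> uedges ?G. v \<in> e} = {}" by (auto simp: delete_def)
  ultimately show False by simp
qed

text \<open>For the independent violator \<open>I\<close>, the set \<open>Q\<close> has at most
  \<open>card I - 1 + card D\<close> elements; this 1 turns the bounds \<open>2 * n - 1\<close> and
  2 of the expansion lemma into \<open>2 * n\<close> and 3.\<close>

lemma torus_deletion_lower_bound:
  assumes n: "n \<ge> 2" and k: "\<And>i. i \<in> {1..n} \<Longrightarrow> k i \<ge> 3" and odd: "odd (k 1)"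
    and D: "D \<subseteq> uverts (torus n k)" and B: "B \<subseteq> uedges (torus n k)"
    and no_fpm: "\<not> has_fpm (delete (torus n k) D B)"
  shows "2 * n \<le> card D + card B \<or>
    n = 2 \<and> k 2 = 4 \<and> 3 \<le> card D + card B \<and> D \<noteq> {}"
proof -
  let ?G = "torus n k" and ?G' = "delete (torus n k) D B"
  have sG: "simple_graph ?G" by (rule simple_graph_torus)
  have sG': "simple_graph ?G'" by (rule simple_graph_delete[OF sG])
  obtain I where I: "I \<subseteq> uverts ?G'" "nbrs ?G' I \<inter> I = {}" "card (nbrs ?G' I) < card I"
    using independent_set_if_not_has_fpm[OF sG' no_fpm] by blast
  define Q where "Q = nbrs ?G' I \<union> D"
  have V: "uverts ?G' = uverts ?G - D" by (simp add: delete_def)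
  have fin: "finite B" using B finite_uedges[OF sG] finite_subset by blast
  have ne: "I \<noteq> {}" using I(3) by auto
  have IV: "I \<subseteq> box {1..n} k" using I(1) V by (auto simp: uverts_torus)
  have QV: "Q \<subseteq> box {1..n} k"
    using D nbrs_subset[OF sG', of I] V by (auto simp: Q_def uverts_torus)
  have IQ: "I \<inter> Q = {}" using I V by (auto simp: Q_def)
  \<comment> \<open>A surviving edge at \<open>I\<close> ends in a neighbour of \<open>I\<close>,
    hence meets \<open>Q\<close>.\<close>
  have sub: "bad_edges n k I Q \<subseteq> B"
  proof
    fix e assume "e \<in> bad_edges n k I Q"
    then have e: "e \<in> uedges ?G" "e \<inter> I \<noteq> {}" "e \<inter> Q = {}" by (auto simp: bad_edges_def)
    show "e \<in> B"
    proof (rule ccontr)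
      assume "e \<notin> B"
      then have e': "e \<in> uedges ?G'" using e by (auto simp: delete_def Q_def)
      obtain x where x: "x \<in> e" "x \<in> I" using e(2) by auto
      obtain a b where ab: "e = {a, b}" using sG e(1) unfolding simple_graph_def by blast
      then obtain y where y: "e = {x, y}" using x(1) by (metis insertE insert_commute singletonD)
      then have "y \<in> nbrs ?G' I" using x e' by (auto simp: nbrs_def)
      then show False using y e(3) by (auto simp: Q_def)
    qed
  qed
  then have X: "card (bad_edges n k I Q) \<le> card B" using fin by (rule card_mono[rotated])
  have cQ: "card Q \<le> card (nbrs ?G' I) + card D" unfolding Q_def by (rule card_Un_le)
  show ?thesis
    using torus_expansion[OF n k odd IV QV IQ ne]
  proof
    assume "card I + 2 * n \<le> card Q + card (bad_edges n k I Q) + 1"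
    then show ?thesis using X cQ I(3) by linarith
  next
    assume ex: "n = 2 \<and> k 2 = 4 \<and> card I \<le> card Q \<and> card I + 2 \<le> card Q + card (bad_edges n k I Q)"
    \<comment> \<open>Without deleted vertices \<open>Q\<close> is the neighbourhood of
      \<open>I\<close>, which is smaller than \<open>I\<close>.\<close>
    have "D \<noteq> {}"
    proof
      assume "D = {}"
      then have "Q = nbrs ?G' I" by (simp add: Q_def)
      moreover have "card I \<le> card Q" using ex by blast
      ultimately show False using I(3) by simp
    qed
    then show ?thesis using ex X cQ I(3) by linarith
  qed
qed

text \<open>A step changes the coordinate by 1, except at the wrap-around, where it changes by
  \<open>K - 1\<close>, which is even exactly for odd \<open>K\<close>.\<close>

lemma cyc_step_even_sum:
  assumes "3 \<le> K" "a < K" "even (cyc_step K b a + a)"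
  shows "odd K \<and> (a = 0 \<and> cyc_step K b a = K - 1 \<or> a = K - 1 \<and> cyc_step K b a = 0)"
  using assms by (cases b) (auto simp: cyc_step_def split: if_splits)

text \<open>With \<open>I\<close> the vertices of even coordinate sum, the only edges inside \<open>I\<close> are the two wrap-around
  edges in the odd direction; \<open>I\<close> contains half of the vertices, so after deleting these two
  edges and one vertex outside \<open>I\<close>, the set \<open>I\<close> has too few neighbours.\<close>

lemma fsmp_torus_odd_4_le:
  assumes k1: "k 1 \<ge> 3" "odd (k 1)" and k2: "k 2 = 4"
  shows "fsmp (torus 2 k) \<le> 3"
proof -
  let ?G = "torus 2 k" and ?J = "{1..2::nat}" and ?m = "k 1"
  have J: "i = 1 \<or> i = 2" if "i \<in> ?J" for i using that by auto
  have kJ: "3 \<le> k i" if "i \<in> ?J" for i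
    using J[OF that] k1 k2 by auto
  have eqI: "x = y" if "x \<in> box ?J k" "y \<in> box ?J k" "x 1 = y 1" "x 2 = y 2" for x y
    using that(3,4) J by (intro box_eqI[OF that(1,2)]) metis
  define z where "z = (\<lambda>i\<in>?J. 0::nat)"
  have "0 < k i" if "i \<in> ?J" for i using kJ[OF that] by simp
  then have z: "z \<in> box ?J k" unfolding z_def box_def by simp
  \<comment> \<open>\<open>d\<close> has odd coordinate sum; \<open>B\<close> consists of the
    wrap-around edges in direction 1 with second coordinate 0 and 2, whose ends both have even
    sum.\<close>
  define d where "d = z(2 := 1)"
  define w where "w = z(2 := 2)"
  define B where "B = {{z, z(1 := ?m - 1)}, {w, w(1 := ?m - 1)}}"
  have z0: "z 1 = 0" "z 2 = 0" by (auto simp: z_def)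
  have dV: "d \<in> box ?J k" and wV: "w \<in> box ?J k"
    unfolding d_def w_def using box_fun_upd[OF z, of 2] k2 by auto
  have wrap: "{x, x(1 := ?m - 1)} \<in> uedges ?G" if "x \<in> box ?J k" "x 1 = 0" for x
    using box_nb_updI[OF kJ that(1), of 1 False] that(2) unfolding uedges_torus
    by (auto simp: cyc_step_def)
  have BE: "B \<subseteq> uedges ?G"
    using wrap[OF z] wrap[OF wV] z0 by (simp add: B_def w_def)
  let ?F = "insert (Inl d) (Inr ` B)"
  have FD: "Inl -` ?F = {d}" and FB: "Inr -` ?F = B" by auto
  have cF: "card ?F \<le> 3" unfolding B_def by (simp add: card_insert_if)
  define I where "I = {x \<in> box ?J k. even (x 1 + x 2)}"
  define P where "P = {x \<in> box ?J k. odd (x 1 + x 2)}"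
  have fin: "finite I" "finite P" by (simp_all add: I_def P_def finite_box)
  \<comment> \<open>A step in direction 2, whose length is even, flips the parity and injects
    \<open>P\<close> into \<open>I\<close>.\<close>
  let ?f = "\<lambda>x. x(2 := cyc_step 4 True (x 2))"
  have x2: "x 2 < 4" if "x \<in> box ?J k" for x using boxD[OF that, of 2] k2 by simp
  have "inj_on ?f P"
  proof (rule inj_onI)
    fix x y assume x: "x \<in> P" and y: "y \<in> P" and eq: "?f x = ?f y"
    have xb: "x \<in> box ?J k" and yb: "y \<in> box ?J k" using x y by (auto simp: P_def)
    have "x 2 = y 2"
      using fun_cong[OF eq, of 2] x2[OF xb] x2[OF yb] by (auto simp: cyc_step_def split: if_splits)
    moreover have "x 1 = y 1" using fun_cong[OF eq, of 1] by simp
    ultimately show "x = y" by (intro eqI[OF xb yb])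
  qed
  moreover have "?f ` P \<subseteq> I"
  proof
    fix y assume "y \<in> ?f ` P"
    then obtain x where x: "x \<in> P" "y = ?f x" by blast
    then have xb: "x \<in> box ?J k" by (simp add: P_def)
    have "y \<in> box ?J k" unfolding x(2)
      using box_fun_upd[OF xb, of 2] cyc_step_less[of 4 "x 2"] x2[OF xb] k2 by simp
    moreover have "odd (cyc_step 4 True (x 2) + x 2)"
      using cyc_step_even_sum[of 4 "x 2" True] x2[OF xb] by auto
    then have "even (y 1 + y 2)" using x by (auto simp: P_def)
    ultimately show "y \<in> I" by (simp add: I_def)
  qed
  ultimately have "card P \<le> card I" using fin card_inj_on_le by blast
  moreover have "d \<in> P" using dV z0 by (simp add: P_def d_def)
  ultimately have less: "card (P - {d}) < card I"
    using fin by (metis card_Diff1_less less_le_trans)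
  have "\<not> has_fpm (delete ?G {d} B)"
  proof (rule not_has_fpm_of_small_nbrs[of _ I "P - {d}"])
    show "simple_graph (delete ?G {d} B)" by (rule simple_graph_delete[OF simple_graph_torus])
    show "I \<subseteq> uverts (delete ?G {d} B)"
      using \<open>d \<in> P\<close> by (auto simp: delete_def uverts_torus I_def P_def)
    show "P - {d} \<subseteq> uverts (delete ?G {d} B)"
      by (auto simp: delete_def uverts_torus P_def)
    show "card (P - {d}) < card I" by (rule less)
    fix e assume "e \<in> uedges (delete ?G {d} B)" and meets: "e \<inter> I \<noteq> {}"
    then have eE: "e \<in> uedges ?G" and eB: "e \<notin> B" and ed: "d \<notin> e" by (auto simp: delete_def)
    obtain x y where e: "e = {x, y}" and y: "y \<in> box_nb ?J k x"
      using eE by (auto simp: uedges_torus)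
    have xb: "x \<in> box ?J k" and yb: "y \<in> box ?J k" using y by (auto simp: box_nb_def)
    obtain i b where i: "i \<in> ?J" and yi: "y = x(i := cyc_step (k i) b (x i))"
      using box_nbE[OF y kJ] by blast
    have mem: "v \<in> I \<or> v \<in> P" "v \<notin> I \<or> v \<notin> P" if "v \<in> box ?J k" for v
      using that by (auto simp: I_def P_def)
    \<comment> \<open>An edge inside \<open>I\<close> must wrap around in direction 1; its second
      coordinate is then 0 or 2, so it belongs to \<open>B\<close>.\<close>
    have "x \<in> I \<longleftrightarrow> y \<in> P"
    proof (rule ccontr)
      assume "\<not> ?thesis"
      then have both: "x \<in> I" "y \<in> I" using mem[OF xb] mem[OF yb] meets e by auto
      have ev: "even (cyc_step (k i) b (x i) + x i)"
        using J[OF i] both unfolding yi I_def by auto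
      from cyc_step_even_sum[OF kJ[OF i] boxD[OF xb i] ev]
      have oddi: "odd (k i)" and
        ends: "x i = 0 \<and> cyc_step (k i) b (x i) = k i - 1 \<or> x i = k i - 1 \<and> cyc_step (k i) b (x i) = 0"
        by auto
      have i1: "i = 1" using J[OF i] oddi k2 by auto
      have "even (x 2)" using both(1) ends k1 i1 by (auto simp: I_def)
      then have x2c: "x 2 = 0 \<or> x 2 = 2" using x2[OF xb] by presburger
      have form: "{x, y} = {v, v(1 := ?m - 1)}" if "v \<in> box ?J k" "v 1 = 0" "v 2 = x 2" for v
      proof -
        have v': "v(1 := ?m - 1) \<in> box ?J k" using box_fun_upd[OF that(1), of 1] k1 by simp
        have y2: "y 2 = x 2" and y1: "y 1 = cyc_step ?m b (x 1)" using yi i1 by simp_all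
        from ends[unfolded i1] show ?thesis
        proof
          assume "x 1 = 0 \<and> cyc_step ?m b (x 1) = ?m - 1"
          note ends' = this
          have "x = v" by (rule eqI[OF xb that(1)]) (use ends' that y1 y2 in auto)
          moreover have "y = v(1 := ?m - 1)"
            by (rule eqI[OF yb v']) (use ends' that y1 y2 in auto)
          ultimately show ?thesis by simp
        next
          assume "x 1 = ?m - 1 \<and> cyc_step ?m b (x 1) = 0"
          note ends' = this
          have "y = v" by (rule eqI[OF yb that(1)]) (use ends' that y1 y2 in auto)
          moreover have "x = v(1 := ?m - 1)"
            by (rule eqI[OF xb v']) (use ends' that y1 y2 in auto)
          ultimately show ?thesis by (simp add: insert_commute)
        qed
      qed
      from x2c show False
        using form[OF z] form[OF wV] z0 eB e by (auto simp: B_def w_def)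
    qed
    then consider "x \<in> I" "y \<in> P" "x \<notin> P" "y \<notin> I" | "y \<in> I" "x \<in> P" "y \<notin> P" "x \<notin> I"
      using mem[OF xb] mem[OF yb] by blast
    then show "e \<inter> (P - {d}) \<noteq> {} \<and> card (e \<inter> I) = 1"
      using e ed by cases auto
  qed
  then have "fsmp ?G \<le> card ?F"
    using dV BE FD FB by (intro fsmp_le) (auto simp: uverts_torus B_def)
  then show ?thesis using cF by simp
qed

theorem theorem4p12:
  fixes n t :: nat and k :: "nat \<Rightarrow> nat"
  assumes "n \<ge> 2"
    and "\<And>i. i \<in> {1..n} \<Longrightarrow> k i \<ge> 3"
    and "1 \<le> t" and "t \<le> n"
    and "\<And>i. i \<in> {1..t} \<Longrightarrow> odd (k i)"
    and "\<And>i. i \<in> {t+1..n} \<Longrightarrow> even (k i)"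
    and "\<And>i j. 1 \<le> i \<Longrightarrow> i \<le> j \<Longrightarrow> j \<le> t \<Longrightarrow> k i \<le> k j"
  shows "fmp (torus n k) = 2 * n \<and>
         fsmp (torus n k) = (if (n, k 2) = (2, 4) then 3 else 2 * n)"
proof -
  let ?G = "torus n k"
  have odd: "odd (k 1)" using assms(3,5) by simp
  have lower: "2 * n \<le> card D + card B \<or> n = 2 \<and> k 2 = 4 \<and> 3 \<le> card D + card B \<and> D \<noteq> {}"
    if "D \<subseteq> uverts ?G" "B \<subseteq> uedges ?G" "\<not> has_fpm (delete ?G D B)" for D B
    using torus_deletion_lower_bound[of n k D B] assms(1,2) odd that by blast
  \<comment> \<open>Isolating the origin costs at most \<open>2 * n\<close> edges, which bounds both
    minima from above.\<close>
  define v where "v = (\<lambda>i\<in>{1..n}. 0::nat)"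
  have "0 < k i" if "i \<in> {1..n}" for i using assms(2)[OF that] by simp
  then have v: "v \<in> box {1..n} k" unfolding v_def box_def by simp
  let ?F = "{e \<in> uedges ?G. v \<in> e}"
  have finF: "finite ?F" using finite_uedges[OF simple_graph_torus] by simp
  have cF: "card ?F \<le> 2 * n" using torus_edges_at[of n k v] assms(2) v by blast
  have no_fpm: "\<not> has_fpm (delete ?G {} ?F)"
    by (rule not_has_fpm_isolated) (simp only: uverts_torus v)
  have "fmp ?G \<le> 2 * n"
    using fmp_le[OF _ finF no_fpm] cF by force
  moreover have "2 * n \<le> fmp ?G"
  proof (rule fmp_ge[OF _ finF no_fpm])
    fix F assume "F \<subseteq> uedges ?G" "\<not> has_fpm (delete ?G {} F)"
    \<comment> \<open>With no vertex deleted, the exceptional alternative contradicts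
      \<open>D \<noteq> {}\<close>.\<close>
    then show "2 * n \<le> card F" using lower[of "{}" F] by simp
  qed auto
  moreover have vim: "Inl -` (Inr ` ?F) = {}" "Inr -` (Inr ` ?F) = ?F" by auto
  have FG: "Inr ` ?F \<subseteq> uverts ?G <+> uedges ?G" by auto
  have finI: "finite (Inr ` ?F)" using finF by simp
  have no_fpm': "\<not> has_fpm (delete ?G (Inl -` (Inr ` ?F)) (Inr -` (Inr ` ?F)))"
    unfolding vim by (rule no_fpm)
  have card_split: "card (Inl -` F) + card (Inr -` F) = card F" if "finite F" for F :: "('a + 'b) set"
  proof -
    have "F = (Inl -` F) <+> (Inr -` F)" by (auto simp: Plus_def image_iff) (metis sum.exhaust)
    then show ?thesis using that by (metis card_Plus finite_vimageI inj_Inl inj_Inr)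
  qed
  have low: "2 * n \<le> card F \<or> n = 2 \<and> k 2 = 4 \<and> 3 \<le> card F"
    if "F \<subseteq> uverts ?G <+> uedges ?G" "finite F" "\<not> has_fpm (delete ?G (Inl -` F) (Inr -` F))" for F
    using lower[OF _ _ that(3)] that(1) card_split[OF that(2)] by auto
  have "fsmp ?G = (if (n, k 2) = (2, 4) then 3 else 2 * n)"
  proof (cases "(n, k 2) = (2, 4)")
    case True
    then have n2: "n = 2" and k2: "k 2 = 4" by auto
    have "3 \<le> fsmp ?G"
    proof (rule fsmp_ge[OF FG finI no_fpm'])
      fix F assume "F \<subseteq> uverts ?G <+> uedges ?G" "finite F"
        "\<not> has_fpm (delete ?G (Inl -` F) (Inr -` F))"
      from low[OF this] show "3 \<le> card F" using n2 by auto
    qed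
    moreover have "fsmp ?G \<le> 3"
      using fsmp_torus_odd_4_le[OF _ odd k2] assms(1,2) n2 by simp
    ultimately show ?thesis using True by simp
  next
    case False
    have "2 * n \<le> fsmp ?G"
    proof (rule fsmp_ge[OF FG finI no_fpm'])
      fix F assume "F \<subseteq> uverts ?G <+> uedges ?G" "finite F"
        "\<not> has_fpm (delete ?G (Inl -` F) (Inr -` F))"
      from low[OF this] show "2 * n \<le> card F" using False by auto
    qed
    moreover have "fsmp ?G \<le> 2 * n"
      by (rule order_trans[OF fsmp_le[OF FG finI no_fpm'] order_trans[OF card_image_le[OF finF] cF]])
    ultimately show ?thesis using False by auto
  qed
  ultimately show ?thesis using order_antisym by blast
qed

end
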